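(* If $X$ is a coverable uniform space with $u\dim X\leq 1$ (in particular if $X$ is compact, coverable, with covering dimension $\dim X\leq 1$), then $\widetilde{X}$ is simply connected, and if moreover $X$ is pathwise connected then the homomorphism $\lambda:\pi_1(X,* )\to\delta_1(X)$ is injective.
   Context: A topological space is called simply connected if every loop in it is null-homotopic, regardless of whether it is pathwise connected. A uniform open cover of a uniform space is an open cover that is refined by the cover by $F$-balls $B(x,F)=\{y:(x,y)\in F\}$ for some fixed entourage $F$. $u\dim X\leq n$ means that every uniform open cover of $X$ has a refinement by a uniform open cover of order $n+1$, i.e. one for which every point lies in at most $n+1$ of its sets. All entourages are taken to be symmetric. Fix a basepoint $*\in X$. For an entourage $E$ of $X$, an $E$-chain from $p$ to $q$ is a finite sequence $\{x_0=p,\dots,x_n=q\}$ with $(x_i,x_{i+1})\in E$ for all $i$; it is an $E$-loop if $p=q$. Two $E$-chains with the same endpoints are $E$-homotopic if one is obtained from the other in finitely many steps, each adding or removing a single point, always keeping the endpoints fixed and keeping an $E$-chain at each stage (in particular $\{p\}$ and $\{p,p\}$ are $E$-homotopic); $[\alpha]_E$ is the class of $\alpha$. $X_E$ is the set of $E$-homotopy classes of $E$-chains starting at $*$. For an entourage $D\subset E$ let $D^*$ be the set of pairs $([*=x_0,\dots,x_n,y]_E,[*=x_0,\dots,x_n,z]_E)$ with $(y,z)\in D$; $X_E$ carries the uniformity with base $\{D^*:D\subset E\}$. For $F\subset E$, $\phi_{EF}:X_F\to X_E$ is $[\alpha]_F\mapsto[\alpha]_E$. $\widetilde{X}=\varprojlim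 X_E$ (over all entourages, ordered by reverse inclusion, with the inverse limit uniformity and basepoint $*=([*]_E)_E$), with projections $\phi_E:\widetilde{X}\to X_E$ and $\phi:\widetilde{X}\to X=X_{X\times X}$. $X$ is coverable if its uniformity has a base, containing $X\times X$, of entourages $E$ for which $\phi_E$ is surjective. $\delta_E(X)$ is the group of $E$-homotopy classes of $E$-loops at $*$ under concatenation. $\delta_1(X)=\varprojlim\delta_E(X)$ (bonding maps $[\lambda]_F\mapsto[\lambda]_E$); as a subset of $\widetilde{X}$ it equals $\phi^{-1}( * )$. Every path $c:[0,1]\to X$ with $c(0)=*$ has a unique continuous lift $c_L:[0,1]\to\widetilde{X}$ with $c_L(0)=*$ and $\phi\circ c_L=c$. The natural homomorphism $\lambda:\pi_1(X,* )\to\delta_1(X)$ is $\lambda([c])=c_L(1)\in\phi^{-1}( * )=\delta_1(X)$, which is well defined. *)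

theory Defs
  imports "HOL-Analysis.Analysis"
begin

section \<open>Entourages, covers and dimension\<close>

text \<open>The uniform space \<open>X\<close> is the universe of a type of class \<^class>\<open>uniform_space\<close> (no
  separation axiom); all entourages are symmetric.\<close>

definition entourage :: "('a::uniform_space \<times> 'a) set \<Rightarrow> bool" where
  "entourage E \<longleftrightarrow> (\<forall>\<^sub>F p in uniformity. p \<in> E) \<and> sym E"

definition open_cover :: "'a::topological_space set set \<Rightarrow> bool" where
  "open_cover \<U> \<longleftrightarrow> (\<forall>U\<in>\<U>. open U) \<and> \<Union>\<U> = UNIV"

definition refines :: "'a set set \<Rightarrow> 'a set set \<Rightarrow> bool" where
  "refines \<V> \<U> \<longleftrightarrow> (\<forall>V\<in>\<V>. \<exists>U\<in>\<U>. V \<subseteq> U)"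

definition uniform_open_cover :: "'a::uniform_space set set \<Rightarrow> bool" where
  "uniform_open_cover \<U> \<longleftrightarrow>
     open_cover \<U> \<and> (\<exists>F. entourage F \<and> refines (range (\<lambda>x. F `` {x})) \<U>)"

definition cover_order_le :: "'a set set \<Rightarrow> nat \<Rightarrow> bool" where
  "cover_order_le \<U> m \<longleftrightarrow> (\<forall>x. finite {U\<in>\<U>. x \<in> U} \<and> card {U\<in>\<U>. x \<in> U} \<le> m)"

definition udim_le :: "'a::uniform_space itself \<Rightarrow> nat \<Rightarrow> bool" where
  "udim_le _ n \<longleftrightarrow>
     (\<forall>\<U>::'a set set. uniform_open_cover \<U> \<longrightarrow>
        (\<exists>\<V>. uniform_open_cover \<V> \<and> refines \<V> \<U> \<and> cover_order_le \<V> (n + 1)))"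

definition covering_dim_le :: "'a::topological_space itself \<Rightarrow> nat \<Rightarrow> bool" where
  "covering_dim_le _ n \<longleftrightarrow>
     (\<forall>\<U>::'a set set. open_cover \<U> \<and> finite \<U> \<longrightarrow>
        (\<exists>\<V>. open_cover \<V> \<and> finite \<V> \<and> refines \<V> \<U> \<and> cover_order_le \<V> (n + 1)))"

section \<open>Chains and their homotopy classes\<close>

definition chain :: "('a \<times> 'a) set \<Rightarrow> 'a list \<Rightarrow> bool" where
  "chain E xs \<longleftrightarrow> xs \<noteq> [] \<and> successively (\<lambda>x y. (x, y) \<in> E) xs"

definition insert_step :: "('a \<times> 'a) set \<Rightarrow> 'a list \<Rightarrow> 'a list \<Rightarrow> bool" where
  "insert_step E xs ys \<longleftrightarrow>
     chain E xs \<and> chain E ys \<and> hd xs = hd ys \<and> last xs = last ys \<and>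
     (\<exists>us x vs. xs = us @ vs \<and> ys = us @ x # vs)"

definition chain_homotopic :: "('a \<times> 'a) set \<Rightarrow> 'a list \<Rightarrow> 'a list \<Rightarrow> bool" where
  "chain_homotopic E = equivclp (insert_step E)"

definition chain_class :: "('a \<times> 'a) set \<Rightarrow> 'a list \<Rightarrow> 'a list set" where
  "chain_class E xs = {ys. chain_homotopic E xs ys}"

definition chain_space :: "'a \<Rightarrow> ('a \<times> 'a) set \<Rightarrow> 'a list set set" where
  "chain_space b E = {chain_class E xs | xs. chain E xs \<and> hd xs = b}"

definition lifted_entourage ::
    "'a \<Rightarrow> ('a \<times> 'a) set \<Rightarrow> ('a \<times> 'a) set \<Rightarrow> ('a list set \<times> 'a list set) set" where
  "lifted_entourage b E D =
     {(chain_class E (xs @ [y]), chain_class E (xs @ [z])) | xs y z.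
        xs \<noteq> [] \<and> hd xs = b \<and> chain E (xs @ [y]) \<and> chain E (xs @ [z]) \<and> (y, z) \<in> D}"

definition chain_uniformity ::
    "'a::uniform_space \<Rightarrow> ('a \<times> 'a) set \<Rightarrow> ('a list set \<times> 'a list set) filter" where
  "chain_uniformity b E =
     (INF D\<in>{D. entourage D \<and> D \<subseteq> E}. principal (lifted_entourage b E D))"

text \<open>The map \<open>[\<alpha>]\<^sub>F \<mapsto> [\<alpha>]\<^sub>E\<close> does not depend on \<open>F\<close> in this encoding: all members of
  the class \<open>[\<alpha>]\<^sub>F\<close> have the same \<open>E\<close>-class when \<open>F \<subseteq> E\<close>.\<close>

definition bonding_map :: "('a \<times> 'a) set \<Rightarrow> 'a list set \<Rightarrow> 'a list set" where
  "bonding_map E C = the_elem (chain_class E ` C)"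

section \<open>The inverse limit\<close>

definition limit_space :: "'a::uniform_space \<Rightarrow> (('a \<times> 'a) set \<Rightarrow> 'a list set) set" where
  "limit_space b =
     {f \<in> \<Pi>\<^sub>E E\<in>{E. entourage E}. chain_space b E.
        \<forall>E F. entourage E \<and> entourage F \<and> F \<subseteq> E \<longrightarrow> bonding_map E (f F) = f E}"

definition limit_base :: "'a::uniform_space \<Rightarrow> ('a \<times> 'a) set \<Rightarrow> 'a list set" where
  "limit_base b = (\<lambda>E\<in>{E. entourage E}. chain_class E [b])"

definition limit_uniformity :: "'a::uniform_space \<Rightarrow>
    ((('a \<times> 'a) set \<Rightarrow> 'a list set) \<times> (('a \<times> 'a) set \<Rightarrow> 'a list set)) filter" where
  "limit_uniformity b =
     inf (INF E\<in>{E. entourage E}.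
            filtercomap (map_prod (\<lambda>f. f E) (\<lambda>f. f E)) (chain_uniformity b E))
         (principal (limit_space b \<times> limit_space b))"

text \<open>The topology on a carrier \<open>S\<close> induced by a uniformity, as in the class
  \<^class>\<open>open_uniformity\<close>.\<close>

definition uniform_topology :: "'b set \<Rightarrow> ('b \<times> 'b) filter \<Rightarrow> 'b topology" where
  "uniform_topology S \<Phi> =
     topology (\<lambda>U. U \<subseteq> S \<and> (\<forall>x\<in>U. \<forall>\<^sub>F (x', y) in \<Phi>. x' = x \<longrightarrow> y \<in> U))"

lemma openin_uniform_topology:
  "openin (uniform_topology S \<Phi>) U \<longleftrightarrow>
     U \<subseteq> S \<and> (\<forall>x\<in>U. \<forall>\<^sub>F (x', y) in \<Phi>. x' = x \<longrightarrow> y \<in> U)"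
proof -
  have "istopology (\<lambda>U. U \<subseteq> S \<and> (\<forall>x\<in>U. \<forall>\<^sub>F (x', y) in \<Phi>. x' = x \<longrightarrow> y \<in> U))"
    unfolding istopology_def
    by (safe; (force elim: eventually_mono eventually_elim2 simp: split_beta'))
  then show ?thesis
    by (simp add: uniform_topology_def topology_inverse')
qed

definition limit_topology :: "'a::uniform_space \<Rightarrow> (('a \<times> 'a) set \<Rightarrow> 'a list set) topology" where
  "limit_topology b = uniform_topology (limit_space b) (limit_uniformity b)"

lemma topspace_limit_topology [simp]: "topspace (limit_topology b) = limit_space b"
proof -
  have "openin (limit_topology b) (limit_space b)"
    unfolding limit_topology_def openin_uniform_topology limit_uniformity_def
    by (auto simp: eventually_inf_principal intro!: always_eventually)
  then show ?thesis
    by (metis limit_topology_def openin_subset openin_topspace openin_uniform_topology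
        subset_antisym)
qed

text \<open>The projection \<open>\<phi>\<close> onto \<open>X\<close>: the component at \<open>X \<times> X\<close>, where a class of chains is
  identified with the common last point of its members.\<close>

definition limit_proj :: "(('a::uniform_space \<times> 'a) set \<Rightarrow> 'a list set) \<Rightarrow> 'a" where
  "limit_proj f = the_elem (last ` f UNIV)"

definition coverable :: "'a::uniform_space \<Rightarrow> bool" where
  "coverable b \<longleftrightarrow>
     (\<exists>\<B>. UNIV \<in> \<B> \<and>
        (\<forall>E\<in>\<B>. entourage E \<and> (\<lambda>f. f E) ` limit_space b = chain_space b E) \<and>
        (\<forall>D. entourage D \<longrightarrow> (\<exists>E\<in>\<B>. E \<subseteq> D)))"

section \<open>Loops\<close>

text \<open>Unlike \<^const>\<open>simply_connected\<close>, the following does not imply path-connectedness.\<close>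

definition loops_null_homotopic :: "'b topology \<Rightarrow> bool" where
  "loops_null_homotopic T \<longleftrightarrow>
     (\<forall>g. pathin T g \<and> g 0 = g 1 \<longrightarrow>
        homotopic_with (\<lambda>h. h 0 = g 0 \<and> h 1 = g 0) (top_of_set {0..1}) T g (\<lambda>_. g 0))"

definition fundamental_group_carrier :: "'a::topological_space \<Rightarrow> (real \<Rightarrow> 'a) set set" where
  "fundamental_group_carrier b =
     {Collect (homotopic_paths UNIV c) | c. path c \<and> pathstart c = b \<and> pathfinish c = b}"

definition is_lift :: "'a::uniform_space \<Rightarrow> (real \<Rightarrow> 'a) \<Rightarrow>
    (real \<Rightarrow> ('a \<times> 'a) set \<Rightarrow> 'a list set) \<Rightarrow> bool" where
  "is_lift b c g \<longleftrightarrow>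
     pathin (limit_topology b) g \<and> g 0 = limit_base b \<and> (\<forall>t\<in>{0..1}. limit_proj (g t) = c t)"

text \<open>The map \<open>\<lambda>\<close> from \<open>\<pi>\<^sub>1(X, b)\<close> to the inverse limit \<open>\<delta>\<^sub>1(X)\<close>, the latter being the
  fibre of \<^const>\<open>limit_proj\<close> over \<open>b\<close>: the endpoint of the lift of any
  representative.\<close>

definition pi1_to_delta1 ::
    "'a::uniform_space \<Rightarrow> (real \<Rightarrow> 'a) set \<Rightarrow> ('a \<times> 'a) set \<Rightarrow> 'a list set" where
  "pi1_to_delta1 b C = (THE z. \<exists>c\<in>C. \<exists>g. is_lift b c g \<and> g 1 = z)"

end

theory Submission
  imports Defs
begin

text \<open>The idea is to see a loop of the inverse limit, projected to a loop \<open>c\<close> of \<open>X\<close>, as the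
  boundary of a family of ever finer triangulated polygons, and to obtain a null-homotopy of \<open>c\<close>
  as their limit.

  Fix an entourage and a uniform cover of order two by small sets. Chains that are fine with respect
  to the cover become walks in its nerve, which is a graph. Since among three members of the cover
  with a common point two coincide, a homotopy of fine chains only inserts and removes backtracks and
  repetitions, and so it preserves the reduced walk. The loop in the inverse limit says that a fine
  subdivision of \<open>c\<close> is homotopic to a constant chain, so its walk reduces to a
  single vertex (\<open>limit_loop_triangulated\<close>). Each cancellation cuts an ear off the inscribed
  polygon of \<open>c\<close>. Hence this polygon is triangulated by noncrossing chords, without interior
  vertices, such that the values of \<open>c\<close> at the corners of each triangle are close.

  Such a triangulation almost gives a map of the disc: a point of a triangle is sent to the value of
  \<open>c\<close> at a corner. Two noncrossing chords that pass close to each other have ends that are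
  close (\<open>noncrossing_chords_close\<close>), so these maps share one modulus of continuity up to jumps
  within the chosen entourage (\<open>triangulated_chord_selection\<close>). A cluster point over all
  entourages is an honest null-homotopy of \<open>c\<close> (\<open>triangulated_imp_null_homotopy\<close>).

  What remains is covering theory. Maps from compact convex sets into \<open>X\<close> lift uniquely to the inverse
  limit (\<open>lift_exists\<close>, \<open>lift_unique\<close>), because a class of chains has exactly one extension to each
  nearby endpoint. Lifting the null-homotopy proves that loops in the inverse limit are
  null-homotopic. If two loops of \<open>X\<close> have lifts with the same endpoint, then the first followed
  by the inverse of the second lifts to a loop and is therefore null-homotopic; this is the
  injectivity of the map on the fundamental group.\<close>

section \<open>Reduction of words\<close>

text \<open>Letters are pushed onto a stack of which the head is the last letter read. A letter that
  repeats the top is ignored, and a letter that returns to the vertex below the top cancels the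
  last step: this is the reduction of walks in a graph by removal of backtracks, that is, the
  endpoint of the lift of the walk to the universal covering tree.\<close>

fun push :: "'v list \<Rightarrow> 'v \<Rightarrow> 'v list" where
  "push [] y = [y]"
| "push [a] y = (if a = y then [a] else [y, a])"
| "push (a # b # S) y = (if a = y then a # b # S else if b = y then b # S else y # a # b # S)"

fun reduced :: "'v list \<Rightarrow> bool" where
  "reduced (a # b # c # S) \<longleftrightarrow> a \<noteq> b \<and> a \<noteq> c \<and> reduced (b # c # S)"
| "reduced [a, b] \<longleftrightarrow> a \<noteq> b"
| "reduced _ \<longleftrightarrow> True"

lemma reduced_push: "reduced S \<Longrightarrow> reduced (push S y)"
  by (induction S rule: reduced.induct) auto

lemma reduced_foldl_push: "reduced S \<Longrightarrow> reduced (foldl push S w)"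
  by (induction w arbitrary: S) (auto simp: reduced_push)

lemma push_nonempty [simp]: "push S y \<noteq> []"
  by (cases "(S, y)" rule: push.cases) auto

lemma hd_push [simp]: "hd (push S y) = y"
  by (cases "(S, y)" rule: push.cases) auto

lemma push_top: "S \<noteq> [] \<Longrightarrow> hd S = y \<Longrightarrow> push S y = S"
  by (cases "(S, y)" rule: push.cases) auto

lemma push_idem [simp]: "push (push S y) y = push S y"
  by (simp add: push_top)

text \<open>Walking along an edge and back does nothing in the covering tree; this is where the stack has
  to be reduced.\<close>

lemma push_backtrack:
  assumes "reduced S" "S \<noteq> []" "hd S = x"
  shows "push (push S y) x = S"
  using assms
proof (cases S rule: reduced.cases)
  case (1 a b c T)
  then show ?thesis using assms by auto
qed auto

text \<open>The condition under which the middle one of three consecutive vertices can be dropped. Three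
  members of a cover of order two with a common point always satisfy it.\<close>

definition collapsible :: "'v \<Rightarrow> 'v \<Rightarrow> 'v \<Rightarrow> bool" where
  "collapsible x y z \<longleftrightarrow> x = y \<or> y = z \<or> x = z"

lemma foldl_push_collapse:
  assumes "reduced S" "collapsible x y z"
  shows "foldl push S (us @ x # y # z # vs) = foldl push S (us @ x # z # vs)"
proof -
  let ?S = "foldl push S us"
  have "reduced (push ?S x)"
    using assms by (simp add: reduced_push reduced_foldl_push)
  then have "push (push (push ?S x) y) z = push (push ?S x) z"
    using assms(2) push_backtrack[of "push ?S x" z y]
    by (auto simp: collapsible_def push_top)
  then show ?thesis by simp
qed

text \<open>A walk followed by its inverse returns to its starting point in the covering tree.\<close>

lemma foldl_push_palindrome:
  assumes "reduced S" "S \<noteq> []" "hd S = x"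
  shows "foldl push S ((x # w) @ rev (x # w)) = S"
  using assms
proof (induction w arbitrary: S x)
  case (Cons y w)
  let ?S = "push S y"
  have "foldl push ?S ((y # w) @ rev (y # w)) = ?S"
    by (rule Cons.IH) (auto simp: reduced_push Cons.prems)
  then show ?case
    using Cons.prems push_backtrack[of S x y] by (simp add: push_top)
qed (auto simp: push_top)

lemma foldl_push_irreducible:
  assumes "\<And>us x y z vs. w = us @ x # y # z # vs \<Longrightarrow> \<not> collapsible x y z"
    and "length w \<noteq> 2"
  shows "foldl push [] w = rev w"
proof -
  have *: "foldl push [a, b] w = rev w @ [a, b]"
    if "a \<noteq> b" "\<And>us x y z vs. b # a # w = us @ x # y # z # vs \<Longrightarrow> \<not> collapsible x y z"
    for a b :: 'a and w
  proof -
    have "foldl push (a # b # S) w = rev w @ a # b # S"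
      if "\<And>us x y z vs. b # a # w = us @ x # y # z # vs \<Longrightarrow> \<not> collapsible x y z" for S
      using that
    proof (induction w arbitrary: a b S)
      case (Cons c w)
      have "\<not> collapsible b a c"
        using Cons.prems[of "[]"] by simp
      moreover have "foldl push (c # a # b # S) w = rev w @ c # a # b # S"
      proof (rule Cons.IH)
        fix us x y z vs
        assume "a # c # w = us @ x # y # z # vs"
        then show "\<not> collapsible x y z"
          using Cons.prems[of "b # us"] by simp
      qed
      ultimately show ?case
        by (auto simp: collapsible_def)
    qed simp
    from this[where S = "[]", OF that(2)] show ?thesis by simp
  qed
  show ?thesis
  proof (cases w rule: reduced.cases)
    case (1 a b c S)
    then have "\<not> collapsible a b c"
      using assms(1)[of "[]"] by simp
    then have "a \<noteq> b" by (simp add: collapsible_def)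
    moreover have "foldl push [b, a] (c # S) = rev (c # S) @ [b, a]"
      by (rule *) (use \<open>a \<noteq> b\<close> assms(1) 1 in auto)
    ultimately show ?thesis using 1 by simp
  qed (use assms in auto)
qed

text \<open>In a tree a closed walk that is not constant must turn back somewhere.\<close>

lemma trivial_word_collapses:
  assumes "foldl push [] w = [v]" "3 \<le> length w"
  obtains us x y z vs where "w = us @ x # y # z # vs" "collapsible x y z"
  using assms foldl_push_irreducible[of w]
  by (metis Suc_n_not_le_n length_Cons length_rev list.size(3) numeral_2_eq_2 numeral_3_eq_3
      Suc_leD)

section \<open>Triangulated intervals\<close>

text \<open>The polygon inscribed in a loop \<open>c\<close> over \<open>[s, t]\<close> is cut by chords into triangles whose
  corners have \<open>E\<close>-close values, down to sides on which \<open>c\<close> is itself \<open>E\<close>-small. The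
  corners are points of the loop itself: filling a loop without further points is possible because
  the nerves are graphs.\<close>

inductive triangulated :: "('a \<times> 'a) set \<Rightarrow> (real \<Rightarrow> 'a) \<Rightarrow> real \<Rightarrow> real \<Rightarrow> bool"
  for E :: "('a \<times> 'a) set" and c :: "real \<Rightarrow> 'a" where
  small: "s \<le> t \<Longrightarrow> (\<And>x y. x \<in> {s..t} \<Longrightarrow> y \<in> {s..t} \<Longrightarrow> (c x, c y) \<in> E) \<Longrightarrow> triangulated E c s t"
| join: "triangulated E c s m \<Longrightarrow> triangulated E c m t \<Longrightarrow> (c s, c t) \<in> E \<Longrightarrow> triangulated E c s t"

lemma triangulated_le: "triangulated E c s t \<Longrightarrow> s \<le> t"
  by (induction rule: triangulated.induct) auto

lemma triangulated_endpoints: "triangulated E c s t \<Longrightarrow> (c s, c t) \<in> E"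
  by (induction rule: triangulated.induct) auto

text \<open>Each removal of a letter from the word of labels cuts off an ear of the polygon: the chord that
  replaces two sides has adjacent, hence \<open>E\<close>-close, ends. A word that reduces to one letter
  therefore yields a triangulation, by induction on the number of its letters.\<close>

lemma triangulated_ear_removal:
  fixes lab :: "real \<Rightarrow> 'v" and adj :: "'v \<Rightarrow> 'v \<Rightarrow> bool"
  assumes "\<And>x. adj (lab x) (lab x)"
    and adj: "\<And>s t. adj (lab s) (lab t) \<Longrightarrow> (c s, c t) \<in> E"
    and "ts \<noteq> []"
    and "successively (\<lambda>s t. triangulated E c s t \<and> adj (lab s) (lab t)) ts"
    and "foldl push [] (map lab ts) = [v]"
  shows "triangulated E c (hd ts) (last ts)"
  using assms(3-)
proof (induction "length ts" arbitrary: ts rule: less_induct)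
  case less
  consider s where "ts = [s]" | s t where "ts = [s, t]" | "3 \<le> length ts"
    using \<open>ts \<noteq> []\<close> by (cases ts rule: reduced.cases) auto
  then show ?case
  proof cases
    case (1 s)
    then show ?thesis using adj[OF assms(1)[of s]]
      by (auto intro!: triangulated.small)
  next
    case (2 s t)
    then show ?thesis using less.prems by simp
  next
    case 3
    then obtain us x y z vs where w: "map lab ts = us @ x # y # z # vs" and xyz: "collapsible x y z"
      using trivial_word_collapses less.prems(3) by (metis length_map)
    then obtain us' s m t vs' where ts: "ts = us' @ s # m # t # vs'"
      and lab: "map lab us' = us" "lab s = x" "lab m = y" "lab t = z" "map lab vs' = vs"
      by (auto simp: map_eq_append_conv map_eq_Cons_conv)
    let ?ts = "us' @ s # t # vs'"
    have sm: "triangulated E c s m" "adj x y" and mt: "triangulated E c m t" "adj y z"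
      using less.prems(2) lab by (auto simp: ts successively_append_iff)
    have "adj x z"
      using sm mt xyz assms(1)[of s] lab by (auto simp: collapsible_def)
    then have st: "triangulated E c s t \<and> adj (lab s) (lab t)"
      using adj[of s t] sm(1) mt(1) lab by (auto intro: triangulated.join)
    have "triangulated E c (hd ?ts) (last ?ts)"
    proof (rule less.hyps)
      show "successively (\<lambda>s t. triangulated E c s t \<and> adj (lab s) (lab t)) ?ts"
        using less.prems(2) st by (auto simp: ts successively_append_iff)
      show "foldl push [] (map lab ?ts) = [v]"
        using less.prems(3) foldl_push_collapse[OF _ xyz, of "[]" us vs] lab by (simp add: ts)
    qed (auto simp: ts)
    moreover have "hd ?ts = hd ts" "last ?ts = last ts"
      by (auto simp: ts hd_append)
    ultimately show ?thesis by simp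
  qed
qed

section \<open>Entourages and uniform covers\<close>

lemma entourage_refl: "entourage E \<Longrightarrow> (x, x) \<in> E"
  unfolding entourage_def using uniformity_refl[of "\<lambda>p. p \<in> E"] by blast

lemma entourage_sym: "entourage E \<Longrightarrow> (x, y) \<in> E \<longleftrightarrow> (y, x) \<in> E"
  by (meson entourage_def symD)

lemma entourage_UNIV [simp]: "entourage UNIV"
  by (simp add: entourage_def sym_def)

lemma entourage_Int: "entourage D \<Longrightarrow> entourage E \<Longrightarrow> entourage (D \<inter> E)"
  by (auto simp: entourage_def eventually_conj_iff sym_Int)

lemma eventually_uniformity_entourage:
  "eventually P uniformity \<longleftrightarrow> (\<exists>E. entourage E \<and> (\<forall>p\<in>E. P p))"
proof
  assume P: "eventually P uniformity"
  let ?E = "{(x, y). P (x, y) \<and> P (y, x)}"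
  have "eventually (\<lambda>p. p \<in> ?E) uniformity"
    using eventually_conj[OF P uniformity_sym[OF P]] by (auto elim: eventually_mono)
  then have "entourage ?E"
    by (auto simp: entourage_def sym_def)
  then show "\<exists>E. entourage E \<and> (\<forall>p\<in>E. P p)"
    by (intro exI[of _ ?E]) auto
next
  assume "\<exists>E. entourage E \<and> (\<forall>p\<in>E. P p)"
  then show "eventually P uniformity"
    unfolding entourage_def by (metis (mono_tags, lifting) eventually_mono)
qed

lemma entourage_half:
  assumes "entourage E"
  obtains D where "entourage D" "\<And>x y z. (x, y) \<in> D \<Longrightarrow> (y, z) \<in> D \<Longrightarrow> (x, z) \<in> E"
proof -
  have "eventually (\<lambda>p. p \<in> E) uniformity"
    using assms by (simp add: entourage_def)
  then obtain P where "eventually P uniformity" "\<And>x y z. P (x, y) \<Longrightarrow> P (y, z) \<Longrightarrow> (x, z) \<in> E"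
    by (rule uniformity_transE) blast
  then show ?thesis
    using that unfolding eventually_uniformity_entourage by metis
qed

lemma entourage_quarter:
  assumes "entourage E"
  obtains D where "entourage D" "D \<subseteq> E"
    "\<And>v w x y z. (v, w) \<in> D \<Longrightarrow> (w, x) \<in> D \<Longrightarrow> (x, y) \<in> D \<Longrightarrow> (y, z) \<in> D \<Longrightarrow> (v, z) \<in> E"
proof -
  obtain D where D: "entourage D" "\<And>x y z. (x, y) \<in> D \<Longrightarrow> (y, z) \<in> D \<Longrightarrow> (x, z) \<in> E"
    by (rule entourage_half[OF assms]) blast
  obtain D' where D': "entourage D'" "\<And>x y z. (x, y) \<in> D' \<Longrightarrow> (y, z) \<in> D' \<Longrightarrow> (x, z) \<in> D"
    by (rule entourage_half[OF D(1)]) blast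
  have "D' \<subseteq> E"
    using D D' entourage_refl by (metis subrelI)
  then show ?thesis
    using D' D(2) that by metis
qed

lemma open_iff_entourage: "open U \<longleftrightarrow> (\<forall>x\<in>U. \<exists>E. entourage E \<and> E `` {x} \<subseteq> U)"
  unfolding open_uniformity eventually_uniformity_entourage by fast

lemma entourage_ball_interior:
  assumes "entourage D" "\<And>x y z. (x, y) \<in> D \<Longrightarrow> (y, z) \<in> D \<Longrightarrow> (x, z) \<in> E"
  shows "D `` {x} \<subseteq> interior (E `` {x})"
proof
  fix y assume "y \<in> D `` {x}"
  then have "eventually (\<lambda>z. z \<in> E `` {x}) (nhds y)"
    unfolding eventually_nhds_uniformity eventually_uniformity_entourage
    using assms by (intro exI[of _ D]) auto
  then show "y \<in> interior (E `` {x})"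
    by (auto simp: eventually_nhds interior_def)
qed

lemma entourage_nhd:
  assumes "entourage E"
  obtains U where "open U" "x \<in> U" "U \<subseteq> E `` {x}"
proof -
  obtain D where D: "entourage D" "\<And>x y z. (x, y) \<in> D \<Longrightarrow> (y, z) \<in> D \<Longrightarrow> (x, z) \<in> E"
    by (rule entourage_half[OF assms]) blast
  have "x \<in> interior (E `` {x})"
    using entourage_ball_interior[OF D(1), of E x] D(2) entourage_refl[OF D(1), of x] by blast
  then show ?thesis
    using that[OF open_interior] interior_subset by blast
qed

lemma continuous_on_iff_entourage:
  fixes f :: "'b::topological_space \<Rightarrow> 'a::uniform_space"
  shows "continuous_on S f \<longleftrightarrow>
    (\<forall>z\<in>S. \<forall>E. entourage E \<longrightarrow> eventually (\<lambda>z'. (f z, f z') \<in> E) (at z within S))"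
proof -
  have "(f \<longlongrightarrow> f z) (at z within S) \<longleftrightarrow>
      (\<forall>E. entourage E \<longrightarrow> eventually (\<lambda>z'. (f z, f z') \<in> E) (at z within S))" for z
  proof
    assume f: "(f \<longlongrightarrow> f z) (at z within S)"
    show "\<forall>E. entourage E \<longrightarrow> eventually (\<lambda>z'. (f z, f z') \<in> E) (at z within S)"
    proof (intro allI impI)
      fix E :: "('a \<times> 'a) set" assume "entourage E"
      then obtain U where "open U" "f z \<in> U" "U \<subseteq> E `` {f z}"
        by (rule entourage_nhd)
      then show "eventually (\<lambda>z'. (f z, f z') \<in> E) (at z within S)"
        using topological_tendstoD[OF f] by (fastforce elim: eventually_mono)
    qed
  next
    assume E: "\<forall>E. entourage E \<longrightarrow> eventually (\<lambda>z'. (f z, f z') \<in> E) (at z within S)"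
    show "(f \<longlongrightarrow> f z) (at z within S)"
    proof (rule topological_tendstoI)
      fix U assume "open U" "f z \<in> U"
      then show "eventually (\<lambda>z'. f z' \<in> U) (at z within S)"
        using E unfolding open_iff_entourage by (fastforce elim: eventually_mono)
    qed
  qed
  then show ?thesis
    by (simp add: continuous_on_def)
qed

lemma uniformly_continuous_entourage:
  fixes f :: "'b::metric_space \<Rightarrow> 'a::uniform_space"
  assumes "compact S" "continuous_on S f" "entourage E"
  obtains \<eta> where "0 < \<eta>" "\<And>x y. x \<in> S \<Longrightarrow> y \<in> S \<Longrightarrow> dist x y < \<eta> \<Longrightarrow> (f x, f y) \<in> E"
proof -
  obtain D where D: "entourage D" "\<And>x y z. (x, y) \<in> D \<Longrightarrow> (y, z) \<in> D \<Longrightarrow> (x, z) \<in> E"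
    by (rule entourage_half[OF assms(3)]) blast
  have "\<exists>d>0. \<forall>y\<in>S. dist y x < d \<longrightarrow> (f x, f y) \<in> D" if "x \<in> S" for x
  proof -
    have "eventually (\<lambda>y. (f x, f y) \<in> D) (at x within S)"
      using assms(2) D(1) that by (auto simp: continuous_on_iff_entourage)
    then show ?thesis
      using entourage_refl[OF D(1)] unfolding eventually_at by (metis zero_less_dist_iff)
  qed
  then obtain d where d: "\<And>x. x \<in> S \<Longrightarrow> 0 < d x"
    "\<And>x y. x \<in> S \<Longrightarrow> y \<in> S \<Longrightarrow> dist y x < d x \<Longrightarrow> (f x, f y) \<in> D"
    by metis
  obtain e where e: "0 < e" "\<And>x. x \<in> S \<Longrightarrow> \<exists>G\<in>(\<lambda>x. ball x (d x)) ` S. ball x e \<subseteq> G"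
  proof (rule Heine_Borel_lemma[OF assms(1), of "(\<lambda>x. ball x (d x)) ` S"])
    show "S \<subseteq> \<Union>((\<lambda>x. ball x (d x)) ` S)"
      using d(1) by force
  qed auto
  show ?thesis
  proof (rule that[OF e(1)])
    fix x y assume xy: "x \<in> S" "y \<in> S" "dist x y < e"
    obtain z where z: "z \<in> S" "ball x e \<subseteq> ball z (d z)"
      using e(2)[OF xy(1)] by blast
    have "x \<in> ball x e" "y \<in> ball x e"
      using xy(3) e(1) by auto
    then have "x \<in> ball z (d z)" "y \<in> ball z (d z)"
      using z(2) by blast+
    then show "(f x, f y) \<in> E"
      using d(2)[OF z(1)] xy D by (metis dist_commute entourage_sym mem_ball)
  qed
qed

lemma uniform_open_coverI:
  assumes "\<And>U. U \<in> \<U> \<Longrightarrow> open U" "entourage F" "\<And>x. \<exists>U\<in>\<U>. F `` {x} \<subseteq> U"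
  shows "uniform_open_cover \<U>"
proof -
  have "x \<in> \<Union>\<U>" for x
  proof -
    obtain U where "U \<in> \<U>" "F `` {x} \<subseteq> U"
      using assms(3)[of x] by auto
    then show ?thesis
      using entourage_refl[OF assms(2), of x] by auto
  qed
  then have "\<Union>\<U> = UNIV" by blast
  then show ?thesis
    using assms unfolding uniform_open_cover_def open_cover_def refines_def by auto
qed

lemma compact_open_cover_uniform:
  assumes "compact (UNIV :: 'a::uniform_space set)" "open_cover (\<V> :: 'a set set)"
  shows "uniform_open_cover \<V>"
proof -
  have "\<exists>D V. V \<in> \<V> \<and> entourage D \<and> (\<forall>y z. (x, y) \<in> D \<longrightarrow> (y, z) \<in> D \<longrightarrow> z \<in> V)" for x
  proof -
    obtain V where V: "V \<in> \<V>" "x \<in> V" "open V"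
      using assms(2) unfolding open_cover_def by (metis UNIV_I UnionE)
    then obtain E where E: "entourage E" "E `` {x} \<subseteq> V"
      using open_iff_entourage by blast
    obtain D where D: "entourage D" "\<And>x y z. (x, y) \<in> D \<Longrightarrow> (y, z) \<in> D \<Longrightarrow> (x, z) \<in> E"
      by (rule entourage_half[OF E(1)]) blast
    have "\<forall>y z. (x, y) \<in> D \<longrightarrow> (y, z) \<in> D \<longrightarrow> z \<in> V"
      using D(2) E(2) by (meson Image_singleton_iff subsetD)
    then show ?thesis
      using V(1) D(1) by blast
  qed
  then obtain D V where DV: "\<And>x. V x \<in> \<V>" "\<And>x. entourage (D x)"
    "\<And>x y z. (x, y) \<in> D x \<Longrightarrow> (y, z) \<in> D x \<Longrightarrow> z \<in> V x"
    by metis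
  have "\<exists>U. open U \<and> x \<in> U \<and> U \<subseteq> D x `` {x}" for x
    using entourage_nhd[OF DV(2)] by metis
  then obtain U where U: "\<And>x. open (U x)" "\<And>x. x \<in> U x" "\<And>x. U x \<subseteq> D x `` {x}"
    by metis
  obtain X where X: "finite X" "UNIV \<subseteq> (\<Union>x\<in>X. U x)"
    using compactE_image[OF assms(1), of UNIV U] U(1,2) by (metis UNIV_I UN_I subsetI)
  let ?F = "\<Inter>x\<in>X. D x"
  have "entourage ?F"
    using X(1) DV(2) by (induction X rule: finite_induct) (auto intro: entourage_Int)
  moreover have "\<exists>V\<in>\<V>. ?F `` {y} \<subseteq> V" for y
  proof -
    obtain x where x: "x \<in> X" "y \<in> U x"
      using X(2) by (meson UNIV_I UN_E subsetD)
    have "?F `` {y} \<subseteq> V x"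
      using x U(3)[of x] DV(3)[of x y] by auto
    then show ?thesis
      using DV(1) by (rule bexI)
  qed
  ultimately show ?thesis
    using assms(2) by (intro uniform_open_coverI) (auto simp: open_cover_def)
qed

lemma compact_covering_dim_imp_udim:
  assumes "compact (UNIV :: 'a::uniform_space set)" "covering_dim_le TYPE('a) n"
  shows "udim_le TYPE('a) n"
  unfolding udim_le_def
proof (intro allI impI)
  fix \<U> :: "'a set set" assume "uniform_open_cover \<U>"
  then have U: "\<forall>U\<in>\<U>. open U" "\<Union>\<U> = UNIV"
    by (auto simp: uniform_open_cover_def open_cover_def)
  obtain \<U>' where U': "\<U>' \<subseteq> \<U>" "finite \<U>'" "UNIV \<subseteq> \<Union>\<U>'"
    by (rule compactE[OF assms(1), of \<U>]) (use U in auto)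
  then have "open_cover \<U>'"
    using U by (auto simp: open_cover_def)
  then have "open_cover \<U>' \<and> finite \<U>'"
    using U'(2) by simp
  then obtain \<V> where V: "open_cover \<V>" "refines \<V> \<U>'" "cover_order_le \<V> (n + 1)"
    using assms(2) unfolding covering_dim_le_def by blast
  have "refines \<V> \<U>"
    using V(2) U'(1) unfolding refines_def by blast
  then show "\<exists>\<V>. uniform_open_cover \<V> \<and> refines \<V> \<U> \<and> cover_order_le \<V> (n + 1)"
    using V compact_open_cover_uniform[OF assms(1)] by blast
qed

lemma small_sets_uniform_open_cover:
  assumes "entourage E"
  shows "uniform_open_cover {U. open U \<and> U \<times> U \<subseteq> E}"
proof -
  obtain D where D: "entourage D" "\<And>x y z. (x, y) \<in> D \<Longrightarrow> (y, z) \<in> D \<Longrightarrow> (x, z) \<in> E"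
    by (rule entourage_half[OF assms]) blast
  obtain F where F: "entourage F" "\<And>x y z. (x, y) \<in> F \<Longrightarrow> (y, z) \<in> F \<Longrightarrow> (x, z) \<in> D"
    by (rule entourage_half[OF D(1)]) blast
  have sub: "F `` {x} \<subseteq> interior (D `` {x})" for x
    by (rule entourage_ball_interior[OF F])
  have mem: "interior (D `` {x}) \<in> {U. open U \<and> U \<times> U \<subseteq> E}" for x
  proof -
    have "(y, z) \<in> E" if "y \<in> interior (D `` {x})" "z \<in> interior (D `` {x})" for y z
    proof -
      have "(x, y) \<in> D" "(x, z) \<in> D"
        using that interior_subset[of "D `` {x}"] by auto
      then show ?thesis
        using D(2)[of y x z] entourage_sym[OF D(1)] by simp
    qed
    then show ?thesis by auto
  qed
  show ?thesis
  proof (rule uniform_open_coverI[OF _ F(1)])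
    show "\<exists>U\<in>{U. open U \<and> U \<times> U \<subseteq> E}. F `` {x} \<subseteq> U" for x
      by (rule bexI[where x = "interior (D `` {x})"], rule sub, rule mem)
  qed simp
qed

lemma cover_order_leD:
  assumes "cover_order_le \<V> 2" "U \<in> \<V>" "V \<in> \<V>" "W \<in> \<V>" "x \<in> U" "x \<in> V" "x \<in> W"
  shows "collapsible U V W"
proof (rule ccontr)
  assume "\<not> collapsible U V W"
  then have "card {U, V, W} = 3"
    by (simp add: collapsible_def)
  moreover have "card {U, V, W} \<le> card {U \<in> \<V>. x \<in> U}"
    using assms by (intro card_mono) (auto simp: cover_order_le_def)
  ultimately show False
    using assms(1) unfolding cover_order_le_def by (metis One_nat_def Suc_1 Suc_n_not_le_n
        le_trans numeral_3_eq_3)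
qed

text \<open>A cover of order two by \<open>E\<close>-small sets, in the form in which it is used: each point is
  labelled by a member of the cover that contains its whole \<open>F\<close>-ball. Points that are \<open>F\<close>-close
  then have intersecting labels, and three points that are \<open>F\<close>-close to one of them have labels
  two of which coincide.\<close>

lemma udim_le_1_labels:
  fixes E :: "('a::uniform_space \<times> 'a) set"
  assumes "udim_le TYPE('a) 1" "entourage E"
  obtains F and V :: "'a \<Rightarrow> 'a set" where "entourage F" "\<And>x. F `` {x} \<subseteq> V x" "\<And>x. V x \<times> V x \<subseteq> E"
    "\<And>x y z p. p \<in> V x \<Longrightarrow> p \<in> V y \<Longrightarrow> p \<in> V z \<Longrightarrow> collapsible (V x) (V y) (V z)"
proof -
  have "\<exists>\<V>. uniform_open_cover \<V> \<and> refines \<V> {U. open U \<and> U \<times> U \<subseteq> E} \<and> cover_order_le \<V> (1 + 1)"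
    using assms(1) small_sets_uniform_open_cover[OF assms(2)] unfolding udim_le_def by (elim allE impE)
  then obtain \<V> where V: "uniform_open_cover \<V>" "refines \<V> {U. open U \<and> U \<times> U \<subseteq> E}"
    "cover_order_le \<V> 2"
    unfolding one_add_one by (elim exE conjE)
  from V(1) obtain F where F: "entourage F" "refines (range (\<lambda>x. F `` {x})) \<V>"
    unfolding uniform_open_cover_def by blast
  have "\<forall>x. \<exists>V. V \<in> \<V> \<and> F `` {x} \<subseteq> V"
    using F(2) unfolding refines_def by blast
  then obtain v where v: "\<And>x. v x \<in> \<V>" "\<And>x. F `` {x} \<subseteq> v x"
    by metis
  have "v x \<times> v x \<subseteq> E" for x
    using V(2) v(1)[of x] unfolding refines_def by blast
  moreover have "collapsible (v x) (v y) (v z)" if "p \<in> v x" "p \<in> v y" "p \<in> v z" for x y z p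
    by (rule cover_order_leD[OF V(3) v(1) v(1) v(1) that])
  ultimately show ?thesis
    by (rule that[OF F(1) v(2)])
qed

section \<open>Noncrossing chords\<close>

text \<open>Plot \<open>[0, 1]\<close> as an arc of a parabola. In the coordinate \<open>x\<close> and the distance \<open>w\<close> to the
  arc, measured vertically, the chord that joins the points with parameters \<open>s\<close> and \<open>t\<close> is the
  curve \<open>w = (x - s) * (t - x)\<close>. Chords with nested or with non-overlapping parameter intervals
  do not cross.\<close>

definition under_chord :: "real \<Rightarrow> real \<Rightarrow> real \<Rightarrow> real \<Rightarrow> bool" where
  "under_chord s t x w \<longleftrightarrow> s \<le> x \<and> x \<le> t \<and> 0 \<le> w \<and> w \<le> (x - s) * (t - x)"

text \<open>The scale of the jumps and that of the move along the loop are kept apart because the \<open>E\<close>-jumps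
  shrink in the limit over all entourages, whereas \<open>\<eta>\<close> measures the continuity of the
  limit.\<close>

definition linked :: "('a \<times> 'a) set \<Rightarrow> (real \<Rightarrow> 'a) \<Rightarrow> real \<Rightarrow> real \<Rightarrow> real \<Rightarrow> bool" where
  "linked E c \<eta> p q \<longleftrightarrow>
     (\<exists>u\<in>{0..1}. \<exists>v\<in>{0..1}. (c p, c u) \<in> E \<and> \<bar>u - v\<bar> < \<eta> \<and> (c v, c q) \<in> E)"

lemma linkedI:
  "(c p, c u) \<in> E \<Longrightarrow> \<bar>u - v\<bar> < \<eta> \<Longrightarrow> (c v, c q) \<in> E \<Longrightarrow> 0 \<le> u \<Longrightarrow> u \<le> 1 \<Longrightarrow> 0 \<le> v \<Longrightarrow> v \<le> 1 \<Longrightarrow>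
    linked E c \<eta> p q"
  unfolding linked_def by (meson atLeastAtMost_iff)

lemma linked_sym: "sym E \<Longrightarrow> linked E c \<eta> p q \<Longrightarrow> linked E c \<eta> q p"
  unfolding linked_def by (metis abs_minus_commute symD)

lemma chord_height_lipschitz:
  fixes s t x x' :: real
  assumes "s \<le> x" "x \<le> t" "s \<le> x'" "x' \<le> t" "t - s \<le> 1"
  shows "(x' - s) * (t - x') \<le> (x - s) * (t - x) + \<bar>x - x'\<bar>"
proof -
  have "(x' - s) * (t - x') - (x - s) * (t - x) = (x' - x) * ((t - x) - (x' - s))"
    by (simp add: algebra_simps)
  also have "\<dots> \<le> \<bar>x' - x\<bar> * \<bar>(t - x) - (x' - s)\<bar>"
    by (metis abs_ge_self abs_mult)
  also have "\<dots> \<le> \<bar>x' - x\<bar> * 1"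
    by (rule mult_left_mono) (use assms in auto)
  finally show ?thesis by (simp add: abs_minus_commute)
qed

text \<open>Moving both ends of a chord outwards by \<open>\<eta>\<close> raises it by at least \<open>\<eta>\<^sup>2\<close>. If
  \<open>(a, b)\<close> were that far inside \<open>(s, t)\<close> at both ends, then \<open>(s, t)\<close> would pass above
  every point \<open>(x, w)\<close> sufficiently near to the point \<open>(x', w')\<close> under \<open>(a, b)\<close>. When \<open>x\<close>
  is outside \<open>[s, t]\<close>, one end of both chords lies between \<open>x\<close> and \<open>x'\<close>.\<close>

lemma noncrossing_chords_close:
  fixes \<eta> :: real
  assumes "s \<le> a" "a \<le> x'" "x' \<le> b" "b \<le> t" "t - s \<le> 1"
    and w': "w' \<le> (x' - a) * (b - x')"
    and "\<not> under_chord s t x w" "0 \<le> w" "0 < \<eta>"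
    and "\<bar>x - x'\<bar> < \<eta>" "\<bar>w - w'\<bar> + \<bar>x - x'\<bar> < \<eta>\<^sup>2"
  shows "\<bar>a - s\<bar> < \<eta> \<or> \<bar>b - t\<bar> < \<eta>"
proof (rule ccontr)
  assume far: "\<not> ?thesis"
  then have "s + \<eta> \<le> a" "b \<le> t - \<eta>"
    using assms(1,4) by auto
  then have x: "s \<le> x" "x \<le> t"
    using assms by auto
  have "w' + \<eta>\<^sup>2 \<le> (x' - a + \<eta>) * (b - x' + \<eta>)"
  proof -
    have "0 \<le> \<eta> * (b - a)"
      using assms by simp
    then show ?thesis
      using w' by (simp add: algebra_simps power2_eq_square)
  qed
  also have "\<dots> \<le> (x' - s) * (t - x')"
    by (rule mult_mono) (use assms \<open>s + \<eta> \<le> a\<close> \<open>b \<le> t - \<eta>\<close> in auto)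
  also have "\<dots> \<le> (x - s) * (t - x) + \<bar>x - x'\<bar>"
    by (rule chord_height_lipschitz) (use assms x in auto)
  also have "\<dots> < w + \<bar>x - x'\<bar>"
    using assms x by (auto simp: under_chord_def)
  finally show False
    using assms by linarith
qed

text \<open>To a point below the chord \<open>(s, t)\<close> one assigns the lowest chord \<open>(a, b)\<close> of the triangulation
  that passes above it, and the value \<open>c a\<close>. Along the way from one point to another the
  triangulation is crossed in chords with \<open>E\<close>-close ends, and by the preceding lemma nearby points
  that lie in different triangles are separated by chords with nearby ends. Hence the assigned
  values vary with a modulus of continuity \<open>\<eta>\<close> that depends on neither the triangulation nor
  \<open>E\<close>, up to \<open>E\<close>-jumps.\<close>

lemma triangulated_chord_selection:
  assumes "triangulated E c s t" "refl E" "sym E" "0 \<le> s" "t \<le> 1"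
  shows "\<exists>a b. (\<forall>x w. under_chord s t x w \<longrightarrow>
        s \<le> a x w \<and> b x w \<le> t \<and> under_chord (a x w) (b x w) x w \<and>
        (c (a x w), c (b x w)) \<in> E \<and> (w = 0 \<longrightarrow> (c (a x w), c x) \<in> E)) \<and>
      (\<forall>x w x' w' \<eta>. under_chord s t x w \<and> under_chord s t x' w' \<and> 0 < \<eta> \<and>
        \<bar>x - x'\<bar> < \<eta> \<and> \<bar>w - w'\<bar> + \<bar>x - x'\<bar> < \<eta>\<^sup>2 \<longrightarrow> linked E c \<eta> (a x w) (a x' w'))"
  using assms(1,4,5)
proof (induction rule: triangulated.induct)
  case (small s t)
  have "linked E c \<eta> s s" if "0 < \<eta>" for \<eta>
    using small that by (intro linkedI[of _ _ s _ s]) auto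
  then show ?case
    using small by (intro exI[of _ "\<lambda>x w. s"] exI[of _ "\<lambda>x w. t"]) (auto simp: under_chord_def)
next
  case (join s m t)
  have m: "s \<le> m" "m \<le> t"
    using join.hyps(1,2) by (auto dest: triangulated_le)
  have E: "(c s, c m) \<in> E" "(c m, c t) \<in> E"
    using join.hyps(1,2) by (auto dest: triangulated_endpoints)
  have "0 \<le> m" "m \<le> 1" "0 \<le> t" "s \<le> 1"
    using m join.prems by auto
  obtain a1 b1 where
    ab1: "\<And>x w. under_chord s m x w \<Longrightarrow> s \<le> a1 x w \<and> b1 x w \<le> m \<and>
        under_chord (a1 x w) (b1 x w) x w \<and> (c (a1 x w), c (b1 x w)) \<in> E \<and>
        (w = 0 \<longrightarrow> (c (a1 x w), c x) \<in> E)"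
    and link1: "\<And>x w x' w' \<eta>. under_chord s m x w \<Longrightarrow> under_chord s m x' w' \<Longrightarrow> 0 < \<eta> \<Longrightarrow>
        \<bar>x - x'\<bar> < \<eta> \<Longrightarrow> \<bar>w - w'\<bar> + \<bar>x - x'\<bar> < \<eta>\<^sup>2 \<Longrightarrow> linked E c \<eta> (a1 x w) (a1 x' w')"
    using join.IH(1)[OF join.prems(1) \<open>m \<le> 1\<close>] by metis
  obtain a2 b2 where
    ab2: "\<And>x w. under_chord m t x w \<Longrightarrow> m \<le> a2 x w \<and> b2 x w \<le> t \<and>
        under_chord (a2 x w) (b2 x w) x w \<and> (c (a2 x w), c (b2 x w)) \<in> E \<and>
        (w = 0 \<longrightarrow> (c (a2 x w), c x) \<in> E)"
    and link2: "\<And>x w x' w' \<eta>. under_chord m t x w \<Longrightarrow> under_chord m t x' w' \<Longrightarrow> 0 < \<eta> \<Longrightarrow>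
        \<bar>x - x'\<bar> < \<eta> \<Longrightarrow> \<bar>w - w'\<bar> + \<bar>x - x'\<bar> < \<eta>\<^sup>2 \<Longrightarrow> linked E c \<eta> (a2 x w) (a2 x' w')"
    using join.IH(2)[OF \<open>0 \<le> m\<close> join.prems(2)] by metis
  \<comment> \<open>In the triangle itself the lowest chord above a point is \<open>(s, t)\<close>.\<close>
  define a where "a x w = (if under_chord s m x w then a1 x w
      else if under_chord m t x w then a2 x w else s)" for x w
  define b where "b x w = (if under_chord s m x w then b1 x w
      else if under_chord m t x w then b2 x w else t)" for x w
  have refl: "(p, p) \<in> E" for p
    using assms(2) by (simp add: reflD)
  have sel: "s \<le> a x w \<and> b x w \<le> t \<and> under_chord (a x w) (b x w) x w \<and>
      (c (a x w), c (b x w)) \<in> E \<and> (w = 0 \<longrightarrow> (c (a x w), c x) \<in> E)"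
    if "under_chord s t x w" for x w
  proof -
    have "w \<noteq> 0" if "\<not> under_chord s m x w" "\<not> under_chord m t x w"
      using that \<open>under_chord s t x w\<close> m by (auto simp: under_chord_def zero_le_mult_iff)
    then show ?thesis
      using that ab1[of x w] ab2[of x w] m join.hyps(3) by (auto simp: a_def b_def)
  qed
  have ab1': "s \<le> a1 x w" "a1 x w \<le> x" "x \<le> b1 x w" "b1 x w \<le> m" "w \<le> (x - a1 x w) * (b1 x w - x)"
      "(c (a1 x w), c (b1 x w)) \<in> E" "(c (b1 x w), c (a1 x w)) \<in> E" if "under_chord s m x w" for x w
    using ab1[OF that] assms(3) by (auto simp: under_chord_def dest: symD)
  have ab2': "m \<le> a2 x w" "a2 x w \<le> x" "x \<le> b2 x w" "b2 x w \<le> t" "w \<le> (x - a2 x w) * (b2 x w - x)"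
      "(c (a2 x w), c (b2 x w)) \<in> E" "(c (b2 x w), c (a2 x w)) \<in> E" if "under_chord m t x w" for x w
    using ab2[OF that] assms(3) by (auto simp: under_chord_def dest: symD)
  \<comment> \<open>A point under the chord \<open>(s, m)\<close> and one in the triangle above it or beyond; the selected chord
    has an end near \<open>s\<close> or near \<open>m\<close>.\<close>
  have 1: "linked E c \<eta> s (a1 x' w')"
    if "under_chord s m x' w'" "\<not> under_chord s m x w" "0 \<le> w" "0 < \<eta>"
      "\<bar>x - x'\<bar> < \<eta>" "\<bar>w - w'\<bar> + \<bar>x - x'\<bar> < \<eta>\<^sup>2" for x w x' w' \<eta>
  proof -
    note p = ab1'[OF that(1)]
    have "\<bar>a1 x' w' - s\<bar> < \<eta> \<or> \<bar>b1 x' w' - m\<bar> < \<eta>"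
      by (rule noncrossing_chords_close[OF p(1-4) _ p(5) that(2-6)]) (use join.prems \<open>m \<le> 1\<close> in auto)
    then show ?thesis
    proof
      assume "\<bar>a1 x' w' - s\<bar> < \<eta>"
      then show ?thesis
        using p join.prems \<open>m \<le> 1\<close> refl by (intro linkedI[of _ _ s _ "a1 x' w'"]) auto
    next
      assume "\<bar>b1 x' w' - m\<bar> < \<eta>"
      then show ?thesis
        using p join.prems \<open>m \<le> 1\<close> E m by (intro linkedI[of _ _ m _ "b1 x' w'"]) auto
    qed
  qed
  have 2: "linked E c \<eta> s (a2 x' w')"
    if "under_chord m t x' w'" "\<not> under_chord m t x w" "0 \<le> w" "0 < \<eta>"
      "\<bar>x - x'\<bar> < \<eta>" "\<bar>w - w'\<bar> + \<bar>x - x'\<bar> < \<eta>\<^sup>2" for x w x' w' \<eta>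
  proof -
    note p = ab2'[OF that(1)]
    have "\<bar>a2 x' w' - m\<bar> < \<eta> \<or> \<bar>b2 x' w' - t\<bar> < \<eta>"
      by (rule noncrossing_chords_close[OF p(1-4) _ p(5) that(2-6)]) (use join.prems \<open>0 \<le> m\<close> in auto)
    then show ?thesis
    proof
      assume "\<bar>a2 x' w' - m\<bar> < \<eta>"
      then show ?thesis
        using p join.prems m E refl by (intro linkedI[of _ _ m _ "a2 x' w'"]) auto
    next
      assume "\<bar>b2 x' w' - t\<bar> < \<eta>"
      then show ?thesis
        using p join.prems m join.hyps(3) by (intro linkedI[of _ _ t _ "b2 x' w'"]) auto
    qed
  qed
  \<comment> \<open>Points under different sides of the triangle: \<open>m\<close> lies between \<open>x\<close> and \<open>x'\<close>, and so do the
    inner ends of both selected chords.\<close>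
  have 12: "linked E c \<eta> (a1 x w) (a2 x' w')"
    if "under_chord s m x w" "under_chord m t x' w'" "\<bar>x - x'\<bar> < \<eta>" for x w x' w' \<eta>
    using that ab1'[OF that(1)] ab2'[OF that(2)] join.prems m refl
    by (intro linkedI[of _ _ "b1 x w" _ "a2 x' w'"]) auto
  have link: "linked E c \<eta> (a x w) (a x' w')"
    if "under_chord s t x w" "under_chord s t x' w'" "0 < \<eta>"
      "\<bar>x - x'\<bar> < \<eta>" "\<bar>w - w'\<bar> + \<bar>x - x'\<bar> < \<eta>\<^sup>2" for x w x' w' \<eta>
  proof -
    have w: "0 \<le> w" "0 \<le> w'"
      using that by (auto simp: under_chord_def)
    have swap: "\<bar>x' - x\<bar> < \<eta>" "\<bar>w' - w\<bar> + \<bar>x' - x\<bar> < \<eta>\<^sup>2"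
      using that by (auto simp: abs_minus_commute)
    have top: "linked E c \<eta> s s"
      using that(3) join.prems \<open>s \<le> 1\<close> refl by (intro linkedI[of _ _ s _ s]) auto
    show ?thesis
      using link1[OF _ _ that(3-5)] link2[OF _ _ that(3-5)] top
        12[OF _ _ that(4)] linked_sym[OF assms(3) 12[OF _ _ swap(1)]]
        1[OF _ _ w(1) that(3-5)] linked_sym[OF assms(3) 1[OF _ _ w(2) that(3) swap]]
        2[OF _ _ w(1) that(3-5)] linked_sym[OF assms(3) 2[OF _ _ w(2) that(3) swap]]
      unfolding a_def by (auto split: if_splits)
  qed
  show ?case
    using sel link by blast
qed

section \<open>Null-homotopies as limits of chord functions\<close>

text \<open>Tychonoff: a net of functions into \<open>[0, 1]\<close>, indexed by the entourages, has a pointwise cluster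
  point. The limit is taken in the compact parameter interval because limits in the uniform space itself
  may fail to exist. Two or more points can be approximated at once, which is what continuity of the
  limit calls for.\<close>

lemma cluster_function:
  fixes q :: "('a::uniform_space \<times> 'a) set \<Rightarrow> 'i \<Rightarrow> real"
  assumes "\<And>E i. entourage E \<Longrightarrow> q E i \<in> {0..1}"
  obtains s where "\<And>i. s i \<in> {0..1}"
    "\<And>E I \<eta>. entourage E \<Longrightarrow> finite I \<Longrightarrow> 0 < \<eta> \<Longrightarrow>
       \<exists>E'. entourage E' \<and> E' \<subseteq> E \<and> (\<forall>i\<in>I. \<bar>q E' i - s i\<bar> < \<eta>)"
proof -
  define \<F> where "\<F> = (INF E\<in>{E. entourage E}. principal (q ` {E'. entourage E' \<and> E' \<subseteq> E}))"
  have ev: "eventually P \<F> \<longleftrightarrow> (\<exists>E. entourage E \<and> (\<forall>E'. entourage E' \<and> E' \<subseteq> E \<longrightarrow> P (q E')))" for P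
  proof -
    have "eventually P \<F> \<longleftrightarrow>
        (\<exists>E\<in>{E. entourage E}. eventually P (principal (q ` {E'. entourage E' \<and> E' \<subseteq> E})))"
      unfolding \<F>_def
    proof (rule eventually_INF_base)
      show "{E :: ('a \<times> 'a) set. entourage E} \<noteq> {}"
        using entourage_UNIV by blast
      fix D E :: "('a \<times> 'a) set"
      assume "D \<in> {E. entourage E}" "E \<in> {E. entourage E}"
      then show "\<exists>E''\<in>{E. entourage E}. principal (q ` {E'. entourage E' \<and> E' \<subseteq> E''})
          \<le> inf (principal (q ` {E'. entourage E' \<and> E' \<subseteq> D})) (principal (q ` {E'. entourage E' \<and> E' \<subseteq> E}))"
        by (intro bexI[of _ "D \<inter> E"]) (auto simp: entourage_Int)
    qed
    then show ?thesis
      by (auto simp: eventually_principal)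
  qed
  have "compact {f :: 'i \<Rightarrow> real. \<forall>i. f i \<in> {0..1}}"
  proof -
    have "compactin (product_topology (\<lambda>i. euclideanreal) UNIV) (PiE (UNIV :: 'i set) (\<lambda>i. {0..1}))"
      by (simp add: compactin_PiE)
    moreover have "PiE (UNIV :: 'i set) (\<lambda>i. {0..1::real}) = {f. \<forall>i. f i \<in> {0..1}}"
      by (auto simp: PiE_def Pi_def)
    ultimately show ?thesis
      by (simp add: euclidean_product_topology)
  qed
  moreover have "\<F> \<noteq> bot"
    using ev[of "\<lambda>_. False"] by (auto simp: trivial_limit_def)
  moreover have "eventually (\<lambda>f. f \<in> {f. \<forall>i. f i \<in> {0..1}}) \<F>"
    unfolding ev using assms by (intro exI[of _ UNIV]) auto
  ultimately obtain s where s: "\<And>i. s i \<in> {0..1}" "inf (nhds s) \<F> \<noteq> bot"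
    unfolding compact_filter by blast
  have "\<exists>E'. entourage E' \<and> E' \<subseteq> E \<and> (\<forall>i\<in>I. \<bar>q E' i - s i\<bar> < \<eta>)"
    if "entourage E" "finite I" "0 < \<eta>" for E I \<eta>
  proof (rule ccontr)
    assume none: "\<not> ?thesis"
    let ?U = "{f. \<forall>i\<in>I. f i \<in> ball (s i) \<eta>}"
    have "open ?U"
      by (rule product_topology_basis'[of I "\<lambda>i. ball (s i) \<eta>" "\<lambda>i. i"]) (use that in auto)
    then have "eventually (\<lambda>f. f \<in> ?U) (nhds s)"
      using that(3) by (auto simp: eventually_nhds intro!: exI[of _ ?U])
    moreover have "eventually (\<lambda>f. f \<notin> ?U) \<F>"
      unfolding ev using none that(1)
      by (intro exI[of _ E]) (auto simp: dist_real_def abs_minus_commute)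
    ultimately have "eventually (\<lambda>_. False) (inf (nhds s) \<F>)"
      by (auto simp: eventually_inf)
    then show False
      using s(2) by (simp add: trivial_limit_def)
  qed
  then show ?thesis
    using that s(1) by blast
qed

text \<open>The square is mapped onto the region between the arc and the chord \<open>(0, 1)\<close>: the side \<open>r = 0\<close>
  goes to the arc, \<open>r = 1\<close> to the chord, and the sides \<open>x = 0\<close> and \<open>x = 1\<close> collapse to its
  ends.\<close>

definition square_height :: "real \<times> real \<Rightarrow> real" where
  "square_height p = fst p * (snd p * (1 - snd p))"

lemma under_square_height:
  assumes "p \<in> {0..1} \<times> {0..1}"
  shows "under_chord 0 1 (snd p) (square_height p)"
  using assms by (auto simp: under_chord_def square_height_def intro!: mult_left_le_one_le)

lemma chord_function:
  assumes "entourage E" "triangulated E c 0 1"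
  shows "\<exists>q. (\<forall>p. q p \<in> {0..1::real}) \<and>
    (\<forall>p\<in>{0..1} \<times> {0..1}. square_height p = 0 \<longrightarrow> (c (q p), c (snd p)) \<in> E) \<and>
    (\<forall>x. 0 < x \<longrightarrow> x < 1 \<longrightarrow> q (1, x) = 0) \<and>
    (\<forall>p\<in>{0..1} \<times> {0..1}. \<forall>p'\<in>{0..1} \<times> {0..1}. \<forall>\<eta>>0. \<bar>snd p - snd p'\<bar> < \<eta> \<longrightarrow>
       \<bar>square_height p - square_height p'\<bar> + \<bar>snd p - snd p'\<bar> < \<eta>\<^sup>2 \<longrightarrow> linked E c \<eta> (q p) (q p'))"
proof -
  have "refl E" "sym E"
    using assms(1) entourage_refl[OF assms(1)] by (auto simp: entourage_def refl_on_def)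
  from triangulated_chord_selection[OF assms(2) this] obtain a b where
    ab: "\<And>x w. under_chord 0 1 x w \<Longrightarrow> 0 \<le> a x w \<and> b x w \<le> 1 \<and>
        under_chord (a x w) (b x w) x w \<and> (c (a x w), c (b x w)) \<in> E \<and>
        (w = 0 \<longrightarrow> (c (a x w), c x) \<in> E)"
    and link: "\<And>x w x' w' \<eta>. under_chord 0 1 x w \<Longrightarrow> under_chord 0 1 x' w' \<Longrightarrow> 0 < \<eta> \<Longrightarrow>
        \<bar>x - x'\<bar> < \<eta> \<Longrightarrow> \<bar>w - w'\<bar> + \<bar>x - x'\<bar> < \<eta>\<^sup>2 \<Longrightarrow> linked E c \<eta> (a x w) (a x' w')"
    by auto metis
  define q where "q p = (if p \<in> {0..1} \<times> {0..1} then a (snd p) (square_height p) else 0)" for p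
  have "q p \<in> {0..1}" for p
    using ab[OF under_square_height, of p] by (auto simp: q_def under_chord_def)
  moreover have "(c (q p), c (snd p)) \<in> E" if "p \<in> {0..1} \<times> {0..1}" "square_height p = 0" for p
    using ab[OF under_square_height[OF that(1)]] that by (simp add: q_def)
  moreover have "q (1, x) = 0" if "0 < x" "x < 1" for x
  proof (rule ccontr)
    let ?a = "a x (x * (1 - x))" and ?b = "b x (x * (1 - x))"
    assume "q (1, x) \<noteq> 0"
    then have "?a \<noteq> 0"
      using that by (simp add: q_def square_height_def)
    have "0 \<le> ?a" "?b \<le> 1" and u: "under_chord ?a ?b x (x * (1 - x))"
      using ab[OF under_square_height[of "(1, x)"]] that by (auto simp: square_height_def)
    have "(x - ?a) * (?b - x) \<le> (x - ?a) * (1 - x)"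
      using u \<open>?b \<le> 1\<close> by (intro mult_left_mono) (auto simp: under_chord_def)
    also have "\<dots> < x * (1 - x)"
      using that \<open>?a \<noteq> 0\<close> \<open>0 \<le> ?a\<close> by (intro mult_strict_right_mono) auto
    finally show False
      using u by (simp add: under_chord_def)
  qed
  moreover have "linked E c \<eta> (q p) (q p')"
    if "p \<in> {0..1} \<times> {0..1}" "p' \<in> {0..1} \<times> {0..1}" "0 < \<eta>" "\<bar>snd p - snd p'\<bar> < \<eta>"
      "\<bar>square_height p - square_height p'\<bar> + \<bar>snd p - snd p'\<bar> < \<eta>\<^sup>2" for p p' \<eta>
    using link[OF under_square_height[OF that(1)] under_square_height[OF that(2)] that(3-5)] that(1,2)
    by (simp only: q_def if_True)
  ultimately show ?thesis
    by (intro exI[of _ q]) simp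
qed

text \<open>The chord functions of the triangulations at the various scales cluster at a function \<open>s\<close>. Any
  two of its values are approximated simultaneously at arbitrarily fine scales, where the
  \<open>E\<close>-jumps become invisible and only the common modulus of continuity remains, so that
  \<open>c \<circ> s\<close> is continuous. On the boundary of the square it agrees with the required values up to
  points that no entourage separates. As the space need not be Hausdorff, the values there are
  replaced by the exact ones, which does not affect continuity.\<close>

lemma triangulated_imp_null_homotopy:
  fixes c :: "real \<Rightarrow> 'a::uniform_space"
  assumes cont: "continuous_on {0..1} c" and loop: "c 1 = c 0"
    and tri: "\<And>E. entourage E \<Longrightarrow> triangulated E c 0 1"
  obtains H :: "real \<times> real \<Rightarrow> 'a" where "continuous_on ({0..1} \<times> {0..1}) H"
    "\<And>x. x \<in> {0..1} \<Longrightarrow> H (0, x) = c x" "\<And>x. x \<in> {0..1} \<Longrightarrow> H (1, x) = c 0"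
    "\<And>r. r \<in> {0..1} \<Longrightarrow> H (r, 0) = c 0" "\<And>r. r \<in> {0..1} \<Longrightarrow> H (r, 1) = c 0"
proof -
  let ?Q = "{0..1} \<times> {0..1::real}"
  let ?h = square_height
  obtain q where q: "\<And>E. entourage E \<Longrightarrow> (\<forall>p. q E p \<in> {0..1}) \<and>
     (\<forall>p\<in>?Q. ?h p = 0 \<longrightarrow> (c (q E p), c (snd p)) \<in> E) \<and>
     (\<forall>x. 0 < x \<longrightarrow> x < 1 \<longrightarrow> q E (1, x) = 0) \<and>
     (\<forall>p\<in>?Q. \<forall>p'\<in>?Q. \<forall>\<eta>>0. \<bar>snd p - snd p'\<bar> < \<eta> \<longrightarrow>
       \<bar>?h p - ?h p'\<bar> + \<bar>snd p - snd p'\<bar> < \<eta>\<^sup>2 \<longrightarrow> linked E c \<eta> (q E p) (q E p'))"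
    using chord_function[OF _ tri] by metis
  have q01: "q E p \<in> {0..1}" if "entourage E" for E p
    using q[OF that] by blast
  have q_base: "(c (q E p), c (snd p)) \<in> E" if "entourage E" "p \<in> ?Q" "?h p = 0" for E p
    using q[OF that(1)] that(2,3) by blast
  have q_top: "q E (1, x) = 0" if "entourage E" "0 < x" "x < 1" for E x
    using q[OF that(1)] that(2,3) by blast
  have q_link: "linked E c \<eta> (q E p) (q E p')"
    if "entourage E" "p \<in> ?Q" "p' \<in> ?Q" "0 < \<eta>" "\<bar>snd p - snd p'\<bar> < \<eta>"
      "\<bar>?h p - ?h p'\<bar> + \<bar>snd p - snd p'\<bar> < \<eta>\<^sup>2" for E p p' \<eta>
    using q[OF that(1)] that(2-6) by blast
  obtain s where s01: "\<And>p. s p \<in> {0..1}"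
    and s: "\<And>E I \<eta>. entourage E \<Longrightarrow> finite I \<Longrightarrow> 0 < \<eta> \<Longrightarrow>
       \<exists>E'. entourage E' \<and> E' \<subseteq> E \<and> (\<forall>p\<in>I. \<bar>q E' p - s p\<bar> < \<eta>)"
    using cluster_function[of q] q01 by metis
  have approx: "\<exists>E'. entourage E' \<and> E' \<subseteq> E \<and> (c (s p), c (q E' p)) \<in> E \<and> (c (s p'), c (q E' p')) \<in> E"
    if E: "entourage E" for E p p'
  proof -
    obtain \<eta> where \<eta>: "0 < \<eta>" "\<And>u v. u \<in> {0..1} \<Longrightarrow> v \<in> {0..1} \<Longrightarrow> dist u v < \<eta> \<Longrightarrow> (c u, c v) \<in> E"
      by (rule uniformly_continuous_entourage[OF compact_Icc cont E]) blast
    obtain E' where E': "entourage E'" "E' \<subseteq> E" "\<forall>i\<in>{p, p'}. \<bar>q E' i - s i\<bar> < \<eta>"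
      using s[OF E _ \<eta>(1), of "{p, p'}"] by auto
    have "(c (s i), c (q E' i)) \<in> E" if "i \<in> {p, p'}" for i
      using E'(3) that by (intro \<eta>(2)[OF s01 q01[OF E'(1)]]) (auto simp: dist_real_def abs_minus_commute)
    then show ?thesis
      using E' by blast
  qed
  have near: "eventually (\<lambda>p'. (c (s p), c (s p')) \<in> D) (at p within ?Q)"
    if D: "entourage D" and p: "p \<in> ?Q" for D p
  proof -
    obtain E where E: "entourage E" "E \<subseteq> D"
      "\<And>v w x y z. (v, w) \<in> E \<Longrightarrow> (w, x) \<in> E \<Longrightarrow> (x, y) \<in> E \<Longrightarrow> (y, z) \<in> E \<Longrightarrow> (v, z) \<in> D"
      by (rule entourage_quarter[OF D]) blast
    obtain G where G: "entourage G" "G \<subseteq> E"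
      "\<And>v w x y z. (v, w) \<in> G \<Longrightarrow> (w, x) \<in> G \<Longrightarrow> (x, y) \<in> G \<Longrightarrow> (y, z) \<in> G \<Longrightarrow> (v, z) \<in> E"
      by (rule entourage_quarter[OF E(1)]) blast
    obtain \<eta> where \<eta>: "0 < \<eta>" "\<And>u v. u \<in> {0..1} \<Longrightarrow> v \<in> {0..1} \<Longrightarrow> dist u v < \<eta> \<Longrightarrow> (c u, c v) \<in> G"
      by (rule uniformly_continuous_entourage[OF compact_Icc cont G(1)]) blast
    have "((\<lambda>p'. \<bar>snd p - snd p'\<bar>) \<longlongrightarrow> 0) (at p within ?Q)"
      by (auto intro!: tendsto_eq_intros)
    moreover have "((\<lambda>p'. \<bar>?h p - ?h p'\<bar> + \<bar>snd p - snd p'\<bar>) \<longlongrightarrow> 0) (at p within ?Q)"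
      unfolding square_height_def by (auto intro!: tendsto_eq_intros)
    moreover have "0 < \<eta>\<^sup>2"
      using \<eta>(1) by simp
    ultimately have "eventually (\<lambda>p'. \<bar>snd p - snd p'\<bar> < \<eta>) (at p within ?Q)"
      "eventually (\<lambda>p'. \<bar>?h p - ?h p'\<bar> + \<bar>snd p - snd p'\<bar> < \<eta>\<^sup>2) (at p within ?Q)"
      using order_tendstoD(2) \<eta>(1) by blast+
    moreover have "eventually (\<lambda>p'. p' \<in> ?Q) (at p within ?Q)"
      by (simp add: eventually_at_filter)
    ultimately show ?thesis
    proof eventually_elim
      case (elim p')
      obtain E' where E': "entourage E'" "E' \<subseteq> G" "(c (s p), c (q E' p)) \<in> G" "(c (s p'), c (q E' p')) \<in> G"
        using approx[OF G(1)] by blast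
      obtain u v where uv: "u \<in> {0..1}" "v \<in> {0..1}" "(c (q E' p), c u) \<in> E'" "\<bar>u - v\<bar> < \<eta>"
          "(c v, c (q E' p')) \<in> E'"
        using q_link[OF E'(1) p elim(3) \<eta>(1) elim(1,2)] unfolding linked_def by blast
      have "(c u, c v) \<in> G"
        using uv \<eta>(2) by (simp add: dist_real_def)
      then have "(c (s p), c v) \<in> E"
        using G(3)[OF E'(3) _ _ entourage_refl[OF G(1)]] uv(3) E'(2) by blast
      moreover have "(c v, c (s p')) \<in> E"
        using G(3)[OF _ _ entourage_refl[OF G(1)] entourage_refl[OF G(1)]] uv(5) E'(2,4)
          entourage_sym[OF G(1)] by blast
      ultimately show ?case
        using E(3)[OF _ _ entourage_refl[OF E(1)] entourage_refl[OF E(1)]] by blast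
    qed
  qed
  have base: "(c x, c (s (r, x))) \<in> D" if D: "entourage D" and "(r, x) \<in> ?Q" "?h (r, x) = 0" for D r x
  proof -
    obtain E where E: "entourage E" "\<And>x y z. (x, y) \<in> E \<Longrightarrow> (y, z) \<in> E \<Longrightarrow> (x, z) \<in> D"
      by (rule entourage_half[OF D]) blast
    obtain E' where "entourage E'" "E' \<subseteq> E" "(c (s (r, x)), c (q E' (r, x))) \<in> E"
      using approx[OF E(1)] by blast
    then have "(c (s (r, x)), c x) \<in> D"
      using E(2) q_base[of E' "(r, x)"] that by (metis snd_conv subsetD)
    then show ?thesis
      using entourage_sym[OF D] by blast
  qed
  have top: "(c 0, c (s (1, x))) \<in> D" if D: "entourage D" and "0 < x" "x < 1" for D x
  proof -
    obtain E' where "entourage E'" "(c (s (1, x)), c (q E' (1, x))) \<in> D"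
      using approx[OF D] by blast
    then show ?thesis
      using q_top[of E' x] that entourage_sym[OF D] by auto
  qed
  \<comment> \<open>The boundary values of \<open>c \<circ> s\<close> are correct only up to inseparable points.\<close>
  define H where "H = (\<lambda>(r, x). if x = 0 \<or> x = 1 \<or> r = 1 then c 0 else if r = 0 then c x else c (s (r, x)))"
  have H: "(H p, c (s p)) \<in> D" if "entourage D" "p \<in> ?Q" for D p
  proof (cases p)
    case (Pair r x)
    with that(2) have "0 \<le> x" "x \<le> 1"
      by auto
    then consider "x = 0 \<or> x = 1" | "x \<noteq> 0" "x \<noteq> 1" "r = 0" | "0 < x" "x < 1" "r = 1"
      | "x \<noteq> 0" "x \<noteq> 1" "r \<noteq> 0" "r \<noteq> 1"
      by fastforce
    then show ?thesis
    proof cases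
      case 1
      then have "H p = c x"
        using loop Pair by (auto simp: H_def)
      then show ?thesis
        using base[OF that(1), of r x] that(2) 1 Pair by (auto simp: square_height_def)
    next
      case 2
      then show ?thesis
        using base[OF that(1), of r x] that(2) Pair by (simp add: H_def square_height_def)
    next
      case 3
      then show ?thesis
        using top[OF that(1), of x] Pair by (simp add: H_def)
    next
      case 4
      then show ?thesis
        using entourage_refl[OF that(1)] Pair by (simp add: H_def)
    qed
  qed
  have "continuous_on ?Q H"
    unfolding continuous_on_iff_entourage
  proof (intro ballI allI impI)
    fix p :: "real \<times> real" and D :: "('a \<times> 'a) set"
    assume p: "p \<in> ?Q" and D: "entourage D"
    obtain E where E: "entourage E" "E \<subseteq> D"
      "\<And>v w x y z. (v, w) \<in> E \<Longrightarrow> (w, x) \<in> E \<Longrightarrow> (x, y) \<in> E \<Longrightarrow> (y, z) \<in> E \<Longrightarrow> (v, z) \<in> D"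
      by (rule entourage_quarter[OF D]) blast
    have "eventually (\<lambda>p'. p' \<in> ?Q) (at p within ?Q)"
      by (simp add: eventually_at_filter)
    with near[OF E(1) p] show "eventually (\<lambda>p'. (H p, H p') \<in> D) (at p within ?Q)"
    proof eventually_elim
      case (elim p')
      show ?case
        using E(3)[OF H[OF E(1) p] elim(1) _ entourage_refl[OF E(1)]] H[OF E(1) elim(2)]
          entourage_sym[OF E(1)] by blast
    qed
  qed
  then show ?thesis
    by (rule that) (auto simp: H_def loop)
qed

section \<open>Classes of chains and their one-point extensions\<close>

lemma chain_homotopic_refl [simp]: "chain_homotopic E xs xs"
  by (simp add: chain_homotopic_def)

lemma chain_homotopic_sym: "chain_homotopic E xs ys \<Longrightarrow> chain_homotopic E ys xs"
  unfolding chain_homotopic_def by (rule equivclp_sym)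

lemma chain_homotopic_trans:
  "chain_homotopic E xs ys \<Longrightarrow> chain_homotopic E ys zs \<Longrightarrow> chain_homotopic E xs zs"
  unfolding chain_homotopic_def by (rule equivclp_trans)

lemma insert_step_imp_chain_homotopic: "insert_step E xs ys \<Longrightarrow> chain_homotopic E xs ys"
  unfolding chain_homotopic_def by (rule r_into_equivclp)

lemma chain_homotopic_induct [consumes 1, case_names refl sym trans step]:
  assumes "chain_homotopic E xs ys"
    and "\<And>xs. R xs xs"
    and "\<And>xs ys. R xs ys \<Longrightarrow> R ys xs"
    and "\<And>xs ys zs. R xs ys \<Longrightarrow> R ys zs \<Longrightarrow> R xs zs"
    and "\<And>xs ys. insert_step E xs ys \<Longrightarrow> R xs ys"
  shows "R xs ys"
  using assms(1) unfolding chain_homotopic_def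
proof (induction rule: equivclp_induct)
  case (step y z)
  then show ?case using assms(3-5) by meson
qed (rule assms(2))

lemma chain_homotopic_invariants:
  assumes "chain_homotopic E xs ys"
  shows "hd xs = hd ys \<and> last xs = last ys \<and> (chain E xs \<longleftrightarrow> chain E ys)"
  using assms by (induction rule: chain_homotopic_induct) (auto simp: insert_step_def)

lemma chain_homotopic_mono:
  assumes "chain_homotopic F xs ys" "F \<subseteq> E"
  shows "chain_homotopic E xs ys"
  using assms(1)
proof (induction rule: chain_homotopic_induct)
  case (step xs ys)
  have "chain F zs \<Longrightarrow> chain E zs" for zs
    using assms(2) unfolding chain_def by (auto elim: successively_mono)
  with step have "insert_step E xs ys"
    unfolding insert_step_def by blast
  then show ?case by (rule insert_step_imp_chain_homotopic)
qed (auto intro: chain_homotopic_sym chain_homotopic_trans)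

lemma chain_append:
  "chain E (xs @ y # ys) \<longleftrightarrow> (xs = [] \<or> chain E xs \<and> (last xs, y) \<in> E) \<and> chain E (y # ys)"
  by (auto simp: chain_def successively_append_iff)

lemma insert_step_append:
  assumes "insert_step E xs ys" "(last xs, z) \<in> E"
  shows "insert_step E (xs @ [z]) (ys @ [z])"
proof -
  have "chain E [z]"
    by (simp add: chain_def)
  then have "chain E (xs @ [z])" "chain E (ys @ [z])"
    using assms by (auto simp: insert_step_def chain_append)
  moreover have "hd (xs @ [z]) = hd (ys @ [z])"
    using assms by (auto simp: insert_step_def chain_def)
  moreover have "\<exists>us x vs. xs @ [z] = us @ vs \<and> ys @ [z] = us @ x # vs"
    using assms(1) unfolding insert_step_def by (metis append.assoc append_Cons)
  ultimately show ?thesis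
    by (simp add: insert_step_def)
qed

lemma chain_homotopic_append:
  assumes "chain_homotopic E xs ys" "(last xs, z) \<in> E"
  shows "chain_homotopic E (xs @ [z]) (ys @ [z])"
  using assms(1) unfolding chain_homotopic_def
proof (induction rule: equivclp_induct)
  case (step y y')
  have "last y = last xs" "last y' = last xs"
    using step.hyps chain_homotopic_invariants[of E xs y]
    by (auto simp: chain_homotopic_def insert_step_def)
  then have "insert_step E (y @ [z]) (y' @ [z]) \<or> insert_step E (y' @ [z]) (y @ [z])"
    using step.hyps assms(2) insert_step_append by metis
  then show ?case
    using step.IH by (meson equivclp_sym equivclp_trans r_into_equivclp)
qed simp

lemma chain_homotopic_remove:
  assumes "chain E (xs @ [y, z])" "xs \<noteq> []" "(last xs, z) \<in> E"
  shows "chain_homotopic E (xs @ [y, z]) (xs @ [z])"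
proof -
  have "insert_step E (xs @ [z]) (xs @ [y, z])"
    using assms by (auto simp: insert_step_def chain_append intro!: exI[of _ xs])
      (auto simp: chain_def)
  then show ?thesis
    by (rule chain_homotopic_sym[OF insert_step_imp_chain_homotopic])
qed

lemma chain_homotopic_duplicate_last:
  assumes "chain E xs" "entourage E"
  shows "chain_homotopic E (xs @ [last xs]) xs"
proof -
  have "xs \<noteq> []"
    using assms(1) by (simp add: chain_def)
  then have "insert_step E xs (xs @ [last xs])"
    using assms entourage_refl[OF assms(2)]
    by (auto simp: insert_step_def chain_append intro!: exI[of _ xs]) (auto simp: chain_def)
  then show ?thesis
    by (rule chain_homotopic_sym[OF insert_step_imp_chain_homotopic])
qed

lemma chain_class_eq_iff: "chain_class E xs = chain_class E ys \<longleftrightarrow> chain_homotopic E xs ys"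
  unfolding chain_class_def by (auto intro: chain_homotopic_sym chain_homotopic_trans
      dest: equalityD2[THEN subsetD, of _ _ ys])

definition endpoint :: "'a list set \<Rightarrow> 'a" where
  "endpoint C = the_elem (last ` C)"

lemma endpoint_chain_class [simp]: "endpoint (chain_class E xs) = last xs"
proof -
  have "last ` chain_class E xs = {last xs}"
    unfolding chain_class_def using chain_homotopic_invariants[of E xs]
    by (auto simp: image_iff intro!: exI[of _ xs])
  then show ?thesis
    by (simp add: endpoint_def)
qed

lemma limit_proj_eq_endpoint: "limit_proj f = endpoint (f UNIV)"
  by (simp add: limit_proj_def endpoint_def)

lemma bonding_map_chain_class:
  assumes "F \<subseteq> E"
  shows "bonding_map E (chain_class F xs) = chain_class E xs"
proof -
  have "chain_class E ` chain_class F xs = {chain_class E xs}"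
  proof -
    have "chain_class E ys = chain_class E xs" if "ys \<in> chain_class F xs" for ys
      using that chain_homotopic_mono[OF _ assms]
      by (auto simp: chain_class_def[of F] chain_class_eq_iff intro: chain_homotopic_sym)
    moreover have "xs \<in> chain_class F xs"
      by (simp add: chain_class_def)
    ultimately show ?thesis by blast
  qed
  then show ?thesis
    by (simp add: bonding_map_def)
qed

text \<open>One step of the chain is the local structure of the space of classes over \<open>X\<close>: for an
  entourage \<open>E\<close> the relation is symmetric, and a class has exactly one extension to each
  \<open>E\<close>-close endpoint.\<close>

definition extends :: "('a \<times> 'a) set \<Rightarrow> 'a list set \<Rightarrow> 'a list set \<Rightarrow> bool" where
  "extends E A B \<longleftrightarrow> (\<exists>xs y. xs \<noteq> [] \<and> chain E (xs @ [y]) \<and> A = chain_class E xs \<and> B = chain_class E (xs @ [y]))"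

lemma extendsI: "chain E xs \<Longrightarrow> (last xs, y) \<in> E \<Longrightarrow> extends E (chain_class E xs) (chain_class E (xs @ [y]))"
  unfolding extends_def by (intro exI[of _ xs] exI[of _ y]) (auto simp: chain_append, auto simp: chain_def)

lemma extends_endpoints: "extends E A B \<Longrightarrow> (endpoint A, endpoint B) \<in> E"
  unfolding extends_def by (auto simp: chain_append)

lemma extends_chain_class:
  assumes "extends E (chain_class E xs) B"
  obtains y where "chain E xs" "(last xs, y) \<in> E" "B = chain_class E (xs @ [y])"
proof -
  obtain zs y where zs: "zs \<noteq> []" "chain E (zs @ [y])" "chain_homotopic E xs zs" "B = chain_class E (zs @ [y])"
    using assms by (auto simp: extends_def chain_class_eq_iff)
  then have "chain E zs" "(last zs, y) \<in> E"
    by (auto simp: chain_append)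
  then show ?thesis
    using zs chain_homotopic_invariants[OF zs(3)] chain_homotopic_append[OF zs(3), of y]
    by (intro that[of y]) (auto simp: chain_class_eq_iff intro: chain_homotopic_sym)
qed

lemma extends_unique:
  assumes "extends E A B" "extends E A B'" "endpoint B = endpoint B'"
  shows "B = B'"
proof -
  obtain xs where "A = chain_class E xs"
    using assms(1) by (auto simp: extends_def)
  then show ?thesis
    using extends_chain_class[of E xs] assms by (metis endpoint_chain_class last_snoc)
qed

text \<open>Two steps whose ends are \<open>E\<close>-close can be replaced by one, since the point between them may be
  removed.\<close>

lemma extends_triangle:
  assumes "extends E A B" "extends E B C" "(endpoint A, endpoint C) \<in> E"
  shows "extends E A C"
proof -
  obtain xs y where xs: "chain E (xs @ [y])" "xs \<noteq> []" "A = chain_class E xs" "B = chain_class E (xs @ [y])"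
    using assms(1) by (auto simp: extends_def)
  obtain z where z: "(y, z) \<in> E" "C = chain_class E (xs @ [y, z])"
    by (rule extends_chain_class[of E "xs @ [y]" C]) (use assms(2) xs in auto)
  moreover have "chain E (xs @ [y, z])"
    using xs z(1) by (auto simp: chain_append) (auto simp: chain_def)
  moreover have "(last xs, z) \<in> E"
    using assms(3) xs(3) z(2) by simp
  ultimately have "C = chain_class E (xs @ [z])"
    using xs(2) by (auto simp: chain_class_eq_iff intro!: chain_homotopic_remove)
  then show ?thesis
    using extendsI[of E xs z] \<open>(last xs, z) \<in> E\<close> xs by (auto simp: chain_append)
qed

lemma extends_refl:
  assumes "entourage E" "A \<in> chain_space b E"
  shows "extends E A A"
proof -
  obtain xs where xs: "A = chain_class E xs" "chain E xs"
    using assms(2) by (auto simp: chain_space_def)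
  then have "extends E A (chain_class E (xs @ [last xs]))"
    using extendsI[OF xs(2)] entourage_refl[OF assms(1)] by simp
  then show ?thesis
    using chain_homotopic_duplicate_last[OF xs(2) assms(1)] xs(1) by (simp add: chain_class_eq_iff[symmetric])
qed

lemma extends_sym:
  assumes "entourage E" "extends E A B"
  shows "extends E B A"
proof -
  obtain xs y where xs: "chain E (xs @ [y])" "xs \<noteq> []" "A = chain_class E xs" "B = chain_class E (xs @ [y])"
    using assms(2) by (auto simp: extends_def)
  then have "chain E xs" "(y, last xs) \<in> E"
    using entourage_sym[OF assms(1)] by (auto simp: chain_append)
  then have *: "extends E B (chain_class E ((xs @ [y]) @ [last xs]))"
    unfolding xs(4) using xs(1) by (intro extendsI) auto
  have "chain E (xs @ [y, last xs])"
    using xs(1) \<open>(y, last xs) \<in> E\<close> by (auto simp: chain_append) (auto simp: chain_def)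
  then have "chain_homotopic E (xs @ [y, last xs]) (xs @ [last xs])"
    using xs(2) entourage_refl[OF assms(1)] by (intro chain_homotopic_remove) auto
  then have "chain_homotopic E (xs @ [y, last xs]) xs"
    using chain_homotopic_duplicate_last[OF \<open>chain E xs\<close> assms(1)] chain_homotopic_trans by metis
  then show ?thesis
    using * xs(3) by (simp add: chain_class_eq_iff[symmetric])
qed

lemma extends_chain_space:
  assumes "extends E A B" "A \<in> chain_space b E"
  shows "B \<in> chain_space b E"
proof -
  obtain xs where xs: "A = chain_class E xs" "chain E xs" "hd xs = b"
    using assms(2) by (auto simp: chain_space_def)
  then obtain y where y: "(last xs, y) \<in> E" "B = chain_class E (xs @ [y])"
    using extends_chain_class assms(1) by metis
  moreover have "chain E (xs @ [y])" "hd (xs @ [y]) = b"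
    using xs y(1) by (auto simp: chain_append) (auto simp: chain_def)
  ultimately show ?thesis
    unfolding chain_space_def by blast
qed

lemma extends_bonding_map:
  assumes "extends F A B" "F \<subseteq> E"
  shows "extends E (bonding_map E A) (bonding_map E B)"
proof -
  obtain xs y where xs: "chain F (xs @ [y])" "xs \<noteq> []" "A = chain_class F xs" "B = chain_class F (xs @ [y])"
    using assms(1) by (auto simp: extends_def)
  then have "chain E (xs @ [y])"
    using assms(2) unfolding chain_def by (auto elim: successively_mono)
  then show ?thesis
    unfolding xs bonding_map_chain_class[OF assms(2)] extends_def using xs(2) by blast
qed

lemma bonding_map_chain_space:
  assumes "A \<in> chain_space b F" "F \<subseteq> E"
  shows "bonding_map E A \<in> chain_space b E" "endpoint (bonding_map E A) = endpoint A"
proof -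
  obtain xs where xs: "A = chain_class F xs" "chain F xs" "hd xs = b"
    using assms(1) by (auto simp: chain_space_def)
  then have "chain E xs"
    using assms(2) unfolding chain_def by (auto elim: successively_mono)
  then show "bonding_map E A \<in> chain_space b E" "endpoint (bonding_map E A) = endpoint A"
    using xs bonding_map_chain_class[OF assms(2)] by (auto simp: chain_space_def)
qed

lemma lifted_entourage_iff_extends:
  assumes "entourage E" "D \<subseteq> E" "A \<in> chain_space b E"
  shows "(A, B) \<in> lifted_entourage b E D \<longleftrightarrow> extends E A B \<and> (endpoint A, endpoint B) \<in> D"
proof
  assume "(A, B) \<in> lifted_entourage b E D"
  then obtain xs y z where *: "A = chain_class E (xs @ [y])" "B = chain_class E (xs @ [z])"
      "xs \<noteq> []" "chain E (xs @ [y])" "chain E (xs @ [z])" "(y, z) \<in> D"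
    unfolding lifted_entourage_def by blast
  have "chain E (xs @ [y, z])"
    using * assms(2) by (auto simp: chain_append) (auto simp: chain_def)
  then have "chain_homotopic E (xs @ [y, z]) (xs @ [z])"
    using * by (intro chain_homotopic_remove) (auto simp: chain_append)
  moreover have "extends E A (chain_class E ((xs @ [y]) @ [z]))"
    unfolding *(1) using * assms(2) by (intro extendsI) auto
  ultimately show "extends E A B \<and> (endpoint A, endpoint B) \<in> D"
    using * by (simp add: chain_class_eq_iff[symmetric])
next
  assume AB: "extends E A B \<and> (endpoint A, endpoint B) \<in> D"
  obtain xs where xs: "A = chain_class E xs" "chain E xs" "hd xs = b"
    using assms(3) by (auto simp: chain_space_def)
  then obtain y where y: "(last xs, y) \<in> E" "B = chain_class E (xs @ [y])"
    using extends_chain_class AB by metis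
  have "A = chain_class E (xs @ [last xs])"
    using chain_homotopic_duplicate_last[OF xs(2) assms(1)] xs(1)
    by (auto simp: chain_class_eq_iff intro: chain_homotopic_sym)
  moreover have "chain E (xs @ [y])" "chain E (xs @ [last xs])" "xs \<noteq> []"
    using xs(2) y(1) entourage_refl[OF assms(1)] by (auto simp: chain_append) (auto simp: chain_def)
  moreover have "(last xs, y) \<in> D"
    using AB xs(1) y(2) by simp
  ultimately show "(A, B) \<in> lifted_entourage b E D"
    unfolding lifted_entourage_def using xs(3) y(2) by blast
qed

section \<open>Unique lifting to the inverse limit\<close>

definition extend :: "('a \<times> 'a) set \<Rightarrow> 'a list set \<Rightarrow> 'a \<Rightarrow> 'a list set" where
  "extend E A y = (THE B. extends E A B \<and> endpoint B = y)"

lemma extend: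
  assumes "A \<in> chain_space b E" "(endpoint A, y) \<in> E"
  shows "extends E A (extend E A y)" "endpoint (extend E A y) = y"
    "extend E A y \<in> chain_space b E"
proof -
  obtain xs where xs: "A = chain_class E xs" "chain E xs"
    using assms(1) by (auto simp: chain_space_def)
  have ex: "extends E A (chain_class E (xs @ [y]))"
    unfolding xs(1) using xs assms(2) by (intro extendsI) auto
  have "extend E A y = chain_class E (xs @ [y])"
    unfolding extend_def
  proof (rule the_equality)
    show "extends E A (chain_class E (xs @ [y])) \<and> endpoint (chain_class E (xs @ [y])) = y"
      using ex by simp
    show "B = chain_class E (xs @ [y])" if "extends E A B \<and> endpoint B = y" for B
      by (rule extends_unique[of E A]) (use ex that in auto)
  qed
  with ex have "extends E A (extend E A y) \<and> endpoint (extend E A y) = y"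
    by simp
  then show "extends E A (extend E A y)" "endpoint (extend E A y) = y"
    "extend E A y \<in> chain_space b E"
    using assms(1) by (auto intro: extends_chain_space)
qed

lemma limit_space_component:
  assumes "f \<in> limit_space b" "entourage E"
  shows "f E \<in> chain_space b E" "endpoint (f E) = limit_proj f"
proof -
  show "f E \<in> chain_space b E"
    using assms by (auto simp: limit_space_def)
  moreover have "bonding_map UNIV (f E) = f UNIV"
    using assms by (auto simp: limit_space_def)
  ultimately show "endpoint (f E) = limit_proj f"
    using bonding_map_chain_space(2)[of "f E" b E UNIV] by (simp add: limit_proj_eq_endpoint)
qed

lemma limit_base_limit_space: "limit_base b \<in> limit_space b" "limit_proj (limit_base b) = b"
  by (auto simp: limit_base_def limit_space_def chain_space_def bonding_map_chain_class chain_def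
      limit_proj_eq_endpoint intro!: exI[of _ "[b]"])

text \<open>A map into classes of \<open>E\<close>-chains is a lift of \<open>f\<close> exactly if it is locally given by one-point
  extension. This condition for all \<open>E\<close> is equivalent to continuity of the map into the inverse
  limit, and lets the components be treated one at a time without their topologies.\<close>

definition local_lift ::
  "'a::uniform_space \<Rightarrow> ('a \<times> 'a) set \<Rightarrow> 'z::topological_space set \<Rightarrow> ('z \<Rightarrow> 'a) \<Rightarrow> ('z \<Rightarrow> 'a list set) \<Rightarrow> bool"
where
  "local_lift b E S f L \<longleftrightarrow>
     (\<forall>z\<in>S. L z \<in> chain_space b E \<and> endpoint (L z) = f z \<and>
        eventually (\<lambda>z'. extends E (L z) (L z')) (at z within S))"

lemma local_liftD:
  assumes "local_lift b E S f L" "z \<in> S"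
  shows "L z \<in> chain_space b E" "endpoint (L z) = f z"
    "eventually (\<lambda>z'. extends E (L z) (L z')) (at z within S)"
  using assms unfolding local_lift_def by blast+

text \<open>Two lifts that agree at a point agree nearby, as extensions are unique; they agree nowhere near a
  point where they differ, as extension can be reversed. So the set where they agree is open and
  closed.\<close>

lemma local_lift_unique:
  assumes "entourage E" "connected S" "local_lift b E S f L" "local_lift b E S f L'"
    and "z0 \<in> S" "z \<in> S" "L z0 = L' z0"
  shows "L z = L' z"
proof (rule connected_induction_simple[OF assms(2,5,6), of "\<lambda>z. L z = L' z"])
  fix a assume a: "a \<in> S"
  have "eventually (\<lambda>z. extends E (L a) (L z) \<and> extends E (L' a) (L' z)) (at a within S)"
    using local_liftD(3)[OF assms(3) a] local_liftD(3)[OF assms(4) a] by (rule eventually_conj)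
  then obtain T where T: "open T" "a \<in> T"
      "\<And>z. z \<in> T \<Longrightarrow> z \<noteq> a \<Longrightarrow> z \<in> S \<Longrightarrow> extends E (L a) (L z) \<and> extends E (L' a) (L' z)"
    unfolding eventually_at_topological by blast
  have ext: "extends E (L a) (L z)" "extends E (L' a) (L' z)" if "z \<in> S \<inter> T" for z
    using T(3)[of z] that extends_refl[OF assms(1)] local_liftD(1)[OF assms(3) a]
      local_liftD(1)[OF assms(4) a] by (cases "z = a"; auto)+
  have "(L a = L' a) = (L z = L' z)" if z: "z \<in> S \<inter> T" for z
  proof
    assume "L a = L' a"
    then show "L z = L' z"
      using ext[OF z] extends_unique[of E "L a" "L z" "L' z"] z
        local_liftD(2)[OF assms(3)] local_liftD(2)[OF assms(4)] by auto
  next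
    assume "L z = L' z"
    then show "L a = L' a"
      using ext[OF z, THEN extends_sym[OF assms(1)]] extends_unique[of E "L z" "L a" "L' a"] a
        local_liftD(2)[OF assms(3)] local_liftD(2)[OF assms(4)] by auto
  qed
  then show "\<exists>T. openin (top_of_set S) T \<and> a \<in> T \<and> (\<forall>x\<in>T. \<forall>y\<in>T. L x = L' x \<longrightarrow> L y = L' y)"
    using T(1,2) a by (intro exI[of _ "S \<inter> T"]) (auto simp: openin_open_Int)
qed (fact assms(7))

lemma chain_uniformity_le: "entourage D \<Longrightarrow> D \<subseteq> E \<Longrightarrow> chain_uniformity b E \<le> principal (lifted_entourage b E D)"
  unfolding chain_uniformity_def by (rule INF_lower) simp

lemma eventually_limit_uniformityI:
  assumes "entourage E" "entourage D" "D \<subseteq> E"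
  shows "eventually (\<lambda>(f, f'). f \<in> limit_space b \<and> f' \<in> limit_space b \<and> (f E, f' E) \<in> lifted_entourage b E D)
    (limit_uniformity b)"
proof -
  have "eventually (\<lambda>(f, f'). (f E, f' E) \<in> lifted_entourage b E D)
      (INF E\<in>{E. entourage E}. filtercomap (map_prod (\<lambda>f. f E) (\<lambda>f. f E)) (chain_uniformity b E))"
  proof (rule filter_leD[OF INF_lower[of E]])
    have "eventually (\<lambda>p. p \<in> lifted_entourage b E D) (chain_uniformity b E)"
      using chain_uniformity_le[OF assms(2,3)] by (auto simp: le_principal)
    then show "eventually (\<lambda>(f, f'). (f E, f' E) \<in> lifted_entourage b E D)
        (filtercomap (map_prod (\<lambda>f. f E) (\<lambda>f. f E)) (chain_uniformity b E))"
      unfolding eventually_filtercomap by (auto intro!: exI)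
  qed (use assms in simp)
  then show ?thesis
    unfolding limit_uniformity_def eventually_inf_principal by (auto elim!: eventually_mono)
qed

text \<open>The set of points of the inverse limit whose \<open>E\<close>-component is an extension of a given class,
  with endpoint in the interior of the \<open>E\<close>-ball, is open: a small change of such a point
  is a second extension step, which merges with the first.\<close>

lemma continuous_map_imp_local_lift:
  fixes b :: "'a::uniform_space" and S :: "'z::topological_space set"
  assumes "entourage E" "continuous_map (top_of_set S) (limit_topology b) g"
  shows "local_lift b E S (limit_proj \<circ> g) (\<lambda>z. g z E)"
  unfolding local_lift_def
proof (intro ballI conjI)
  fix z assume z: "z \<in> S"
  have gS: "g z \<in> limit_space b" if "z \<in> S" for z
    using assms(2) that by (auto simp: continuous_map_def)
  note A = limit_space_component[OF gS[OF z] assms(1)]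
  show "g z E \<in> chain_space b E" "endpoint (g z E) = (limit_proj \<circ> g) z"
    using A by simp_all
  let ?A = "g z E"
  let ?W = "interior (E `` {endpoint ?A})"
  let ?U = "{f \<in> limit_space b. extends E ?A (f E) \<and> endpoint (f E) \<in> ?W}"
  have "openin (limit_topology b) ?U"
    unfolding limit_topology_def openin_uniform_topology
  proof (intro conjI ballI)
    fix f assume f: "f \<in> ?U"
    then obtain D where D: "entourage D" "D `` {endpoint (f E)} \<subseteq> ?W"
      using open_iff_entourage open_interior by blast
    have "eventually (\<lambda>(f, f'). f \<in> limit_space b \<and> f' \<in> limit_space b \<and>
        (f E, f' E) \<in> lifted_entourage b E (D \<inter> E)) (limit_uniformity b)"
      by (rule eventually_limit_uniformityI) (use assms(1) D entourage_Int in auto)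
    then show "eventually (\<lambda>(f1, f'). f1 = f \<longrightarrow> f' \<in> ?U) (limit_uniformity b)"
    proof (rule eventually_mono, clarify)
      fix f' assume f': "f' \<in> limit_space b" "(f E, f' E) \<in> lifted_entourage b E (D \<inter> E)"
      have "f E \<in> chain_space b E"
        using limit_space_component(1)[OF _ assms(1)] f by auto
      then have e: "extends E (f E) (f' E)" "(endpoint (f E), endpoint (f' E)) \<in> D"
        using f'(2) lifted_entourage_iff_extends[OF assms(1), of "D \<inter> E"] by auto
      then have W: "endpoint (f' E) \<in> ?W"
        using D(2) by blast
      then have "(endpoint ?A, endpoint (f' E)) \<in> E"
        using interior_subset by fastforce
      then show "extends E ?A (f' E) \<and> endpoint (f' E) \<in> ?W"
        using f e W extends_triangle by blast
    qed
  qed auto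
  moreover have "g z \<in> ?U"
  proof -
    obtain V where "open V" "endpoint ?A \<in> V" "V \<subseteq> E `` {endpoint ?A}"
      by (rule entourage_nhd[OF assms(1)])
    then have "endpoint ?A \<in> ?W"
      by (rule interiorI)
    then show ?thesis
      using gS[OF z] extends_refl[OF assms(1) A(1)] by simp
  qed
  ultimately have "openin (top_of_set S) {z'\<in>S. g z' \<in> ?U}" "z \<in> {z'\<in>S. g z' \<in> ?U}"
    using assms(2) z by (auto simp: continuous_map_def)
  then show "eventually (\<lambda>z'. extends E ?A (g z' E)) (at z within S)"
    unfolding eventually_at_topological openin_open by blast
qed

lemma local_lift_imp_continuous_map:
  fixes b :: "'a::uniform_space" and S :: "'z::topological_space set"
  assumes "\<And>z. z \<in> S \<Longrightarrow> g z \<in> limit_space b" "continuous_on S f"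
    and "\<And>E. entourage E \<Longrightarrow> local_lift b E S f (\<lambda>z. g z E)"
  shows "continuous_map (top_of_set S) (limit_topology b) g"
proof -
  have lim: "filterlim (\<lambda>z'. (g z, g z')) (limit_uniformity b) (at z within S)" if z: "z \<in> S" for z
    unfolding limit_uniformity_def filterlim_inf filterlim_INF filterlim_filtercomap_iff
      chain_uniformity_def filterlim_principal
  proof (intro conjI ballI)
    show "eventually (\<lambda>z'. (g z, g z') \<in> limit_space b \<times> limit_space b) (at z within S)"
      using assms(1) z by (auto simp: eventually_at_filter)
    fix E D :: "('a \<times> 'a) set"
    assume E: "E \<in> {E. entourage E}" and D: "D \<in> {D. entourage D \<and> D \<subseteq> E}"
    then have L: "local_lift b E S f (\<lambda>z. g z E)"
      by (simp add: assms(3))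
    have "eventually (\<lambda>z'. (f z, f z') \<in> D) (at z within S)"
      using assms(2) z D by (simp add: continuous_on_iff_entourage)
    moreover have "eventually (\<lambda>z'. z' \<in> S) (at z within S)"
      by (simp add: eventually_at_filter)
    ultimately have "eventually (\<lambda>z'. (g z E, g z' E) \<in> lifted_entourage b E D) (at z within S)"
      using local_liftD(3)[OF L z]
    proof eventually_elim
      case (elim z')
      then show ?case
        using E D lifted_entourage_iff_extends[of E D "g z E" b "g z' E"] local_liftD(1,2)[OF L] z by simp
    qed
    then show "eventually (\<lambda>z'. (map_prod (\<lambda>f. f E) (\<lambda>f. f E) \<circ> (\<lambda>z'. (g z, g z'))) z'
        \<in> lifted_entourage b E D) (at z within S)"
      by simp
  qed
  show ?thesis
    unfolding continuous_map_def
  proof (intro conjI allI impI)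
    show "g \<in> topspace (top_of_set S) \<rightarrow> topspace (limit_topology b)"
      using assms(1) by simp
    fix U assume U: "openin (limit_topology b) U"
    show "openin (top_of_set S) {z \<in> topspace (top_of_set S). g z \<in> U}"
    proof (subst openin_subopen, intro ballI)
      fix z assume "z \<in> {z \<in> topspace (top_of_set S). g z \<in> U}"
      then have z: "z \<in> S" "g z \<in> U" by auto
      have "eventually (\<lambda>(f, f'). f = g z \<longrightarrow> f' \<in> U) (limit_uniformity b)"
        using U z(2) unfolding limit_topology_def openin_uniform_topology by blast
      then have "eventually (\<lambda>z'. g z' \<in> U) (at z within S)"
        using filterlim_iff[THEN iffD1, OF lim[OF z(1)]] by fastforce
      then obtain T where "open T" "z \<in> T" "\<And>z'. z' \<in> T \<Longrightarrow> z' \<noteq> z \<Longrightarrow> z' \<in> S \<Longrightarrow> g z' \<in> U"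
        unfolding eventually_at_topological by blast
      then show "\<exists>T. openin (top_of_set S) T \<and> z \<in> T \<and> T \<subseteq> {z \<in> topspace (top_of_set S). g z \<in> U}"
        using z by (intro exI[of _ "S \<inter> T"]) (auto simp: openin_open_Int)
    qed
  qed
qed

lemma continuous_on_limit_proj:
  fixes b :: "'a::uniform_space" and S :: "'z::topological_space set"
  assumes "continuous_map (top_of_set S) (limit_topology b) g"
  shows "continuous_on S (limit_proj \<circ> g)"
  unfolding continuous_on_iff_entourage
proof (intro ballI allI impI)
  fix z :: 'z and E :: "('a \<times> 'a) set"
  assume z: "z \<in> S" and E: "entourage E"
  note L = continuous_map_imp_local_lift[OF E assms]
  have "eventually (\<lambda>z'. z' \<in> S) (at z within S)"
    by (simp add: eventually_at_filter)
  with local_liftD(3)[OF L z]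
  show "eventually (\<lambda>z'. ((limit_proj \<circ> g) z, (limit_proj \<circ> g) z') \<in> E) (at z within S)"
  proof eventually_elim
    case (elim z')
    then show ?case
      using extends_endpoints local_liftD(2)[OF L] z by metis
  qed
qed

lemma limit_space_eqI:
  assumes "f \<in> limit_space b" "f' \<in> limit_space b" "\<And>E. entourage E \<Longrightarrow> f E = f' E"
  shows "f = f'"
  using assms by (intro PiE_ext[of f "{E. entourage E}" "chain_space b" f']) (auto simp: limit_space_def)

lemma lift_unique:
  fixes b :: "'a::uniform_space" and S :: "'z::topological_space set"
  assumes "connected S"
    and "continuous_map (top_of_set S) (limit_topology b) g" "continuous_map (top_of_set S) (limit_topology b) g'"
    and proj: "\<And>z. z \<in> S \<Longrightarrow> limit_proj (g z) = limit_proj (g' z)"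
    and "z0 \<in> S" "z \<in> S" "g z0 = g' z0"
  shows "g z = g' z"
proof (rule limit_space_eqI)
  show "g z \<in> limit_space b" "g' z \<in> limit_space b"
    using assms(2,3,6) by (auto simp: continuous_map_def)
  fix E :: "('a \<times> 'a) set" assume E: "entourage E"
  have "local_lift b E S (limit_proj \<circ> g) (\<lambda>z. g' z E)"
    using continuous_map_imp_local_lift[OF E assms(3)] proj by (simp add: local_lift_def)
  then show "g z E = g' z E"
    using local_lift_unique[OF E assms(1) continuous_map_imp_local_lift[OF E assms(2)] _ assms(5,6)]
      assms(7) by simp
qed

section \<open>Existence of lifts\<close>

text \<open>The class at \<open>z\<close> is obtained from \<open>A\<close> by following \<open>f\<close> in \<open>n\<close> steps along the segment from
  \<open>z0\<close> to \<open>z\<close>. For nearby \<open>z\<close> and \<open>z'\<close> the two chains form a ladder whose rungs and diagonals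
  are \<open>E\<close>-close, so that at each stage one class extends the other.\<close>

lemma component_lift_exists:
  fixes f :: "'z::real_normed_vector \<Rightarrow> 'a::uniform_space"
  assumes S: "compact S" "convex S" "z0 \<in> S" and f: "continuous_on S f"
    and E: "entourage E" and A: "A \<in> chain_space b E" "endpoint A = f z0"
  obtains L where "local_lift b E S f L" "L z0 = A"
proof -
  obtain \<eta> where \<eta>: "0 < \<eta>" "\<And>x y. x \<in> S \<Longrightarrow> y \<in> S \<Longrightarrow> dist x y < \<eta> \<Longrightarrow> (f x, f y) \<in> E"
    by (rule uniformly_continuous_entourage[OF S(1) f E]) blast
  obtain M where M: "\<And>z. z \<in> S \<Longrightarrow> dist z0 z \<le> M"
    using compact_imp_bounded[OF S(1)] unfolding bounded_any_center[of S z0] by blast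
  have "0 \<le> M"
    using M[OF S(3)] by simp
  obtain n :: nat where n: "2 * M / \<eta> < n"
    using reals_Archimedean2 by blast
  then have "0 < n"
    using \<open>0 \<le> M\<close> \<eta>(1) by (metis divide_nonneg_pos gr0I less_le_not_le mult_nonneg_nonneg of_nat_0
        zero_le_numeral)
  have step: "M / n < \<eta> / 2"
    using n \<eta>(1) \<open>0 < n\<close> by (simp add: field_simps)
  define pt where "pt z k = z0 + (real k / real n) *\<^sub>R (z - z0)" for z k
  define X where "X z = rec_nat A (\<lambda>k B. extend E B (f (pt z (Suc k))))" for z
  have X0: "X z 0 = A" and XSuc: "X z (Suc k) = extend E (X z k) (f (pt z (Suc k)))" for z k
    by (simp_all add: X_def)
  have pt0: "pt z 0 = z0" and ptn: "pt z n = z" and ptz0: "pt z0 k = z0" for z k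
    using \<open>0 < n\<close> by (simp_all add: pt_def)
  have ptS: "pt z k \<in> S" if "z \<in> S" "k \<le> n" for z k
    using convexD_alt[OF S(2,3) that(1), of "real k / real n"] that(2) \<open>0 < n\<close>
    by (simp add: pt_def algebra_simps)
  have pt_step: "dist (pt z k) (pt z (Suc k)) < \<eta> / 2" if "z \<in> S" for z k
  proof -
    have "pt z (Suc k) - pt z k = (1 / real n) *\<^sub>R (z - z0)"
      by (simp add: pt_def add_divide_distrib scaleR_add_left)
    then have "dist (pt z k) (pt z (Suc k)) = dist z0 z / n"
      by (metis abs_divide abs_of_nat abs_one dist_commute dist_norm divide_inverse
          mult.commute mult.left_neutral norm_scaleR)
    also have "\<dots> \<le> M / n"
      using M[OF that] by (simp add: divide_right_mono)
    finally show ?thesis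
      using step by linarith
  qed
  have pt_dist: "dist (pt z k) (pt z' k) \<le> dist z z'" if "k \<le> n" for z z' k
  proof -
    have "pt z k - pt z' k = (real k / real n) *\<^sub>R (z - z')"
      by (simp add: pt_def algebra_simps)
    then have "dist (pt z k) (pt z' k) = (real k / real n) * dist z z'"
      by (simp add: dist_norm)
    also have "\<dots> \<le> dist z z'"
      using that \<open>0 < n\<close> by (intro mult_left_le_one_le) auto
    finally show ?thesis .
  qed
  have X: "X z k \<in> chain_space b E \<and> endpoint (X z k) = f (pt z k)" if "z \<in> S" "k \<le> n" for z k
    using that(2)
  proof (induction k)
    case 0
    then show ?case using A by (simp add: X0 pt0)
  next
    case (Suc k)
    have "(f (pt z k), f (pt z (Suc k))) \<in> E"
      using pt_step[OF that(1), of k] \<eta>(1) Suc.prems that(1) by (intro \<eta>(2) ptS) auto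
    then show ?case
      using Suc extend[of "X z k" b E "f (pt z (Suc k))"] by (simp add: XSuc)
  qed
  have X_step: "extends E (X z k) (X z (Suc k))" if "z \<in> S" "Suc k \<le> n" for z k
  proof -
    have "(f (pt z k), f (pt z (Suc k))) \<in> E"
      using pt_step[OF that(1), of k] \<eta>(1) that by (intro \<eta>(2) ptS) auto
    then show ?thesis
      using X[of z k] that extend[of "X z k" b E "f (pt z (Suc k))"] by (simp add: XSuc)
  qed
  have ladder: "extends E (X z k) (X z' k)" if z: "z \<in> S" "z' \<in> S" "dist z z' < \<eta> / 2" and "k \<le> n" for z z' k
    using that(4)
  proof (induction k)
    case 0
    then show ?case using extends_refl[OF E A(1)] by (simp add: X0)
  next
    case (Suc k)
    note S = X_step[OF z(1) Suc.prems, THEN extends_sym[OF E]] and S' = X_step[OF z(2) Suc.prems]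
    have "dist (pt z k) (pt z' (Suc k)) < \<eta>"
      using dist_triangle[of "pt z k" "pt z' (Suc k)" "pt z' k"] pt_dist[of k z z'] pt_step[OF z(2), of k]
        z(3) Suc.prems by simp
    then have "(f (pt z k), f (pt z' (Suc k))) \<in> E"
      using z Suc.prems by (intro \<eta>(2) ptS) auto
    then have "extends E (X z k) (X z' (Suc k))"
      using extends_triangle[OF _ S', of "X z k"] Suc X[OF z(1), of k] X[OF z(2), of "Suc k"] by simp
    moreover have "(f (pt z (Suc k)), f (pt z' (Suc k))) \<in> E"
      using pt_dist[of "Suc k" z z'] z \<eta>(1) Suc.prems by (intro \<eta>(2) ptS) auto
    ultimately show ?case
      using extends_triangle[OF S] Suc.prems X[OF z(1), of "Suc k"] X[OF z(2), of "Suc k"] by simp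
  qed
  have "local_lift b E S f (\<lambda>z. X z n)"
    unfolding local_lift_def
  proof (intro ballI conjI)
    fix z assume z: "z \<in> S"
    show "X z n \<in> chain_space b E" "endpoint (X z n) = f z"
      using X[OF z, of n] ptn by auto
    show "eventually (\<lambda>z'. extends E (X z n) (X z' n)) (at z within S)"
      unfolding eventually_at using ladder[OF z, of _ n] \<eta>(1)
      by (intro exI[of _ "\<eta> / 2"]) (auto simp: dist_commute)
  qed
  moreover have "X z0 k = A" if "k \<le> n" for k
    using that
  proof (induction k)
    case (Suc k)
    then have "extends E A (X z0 (Suc k))"
      using X_step[OF S(3), of k] by simp
    then show ?case
      using extends_unique[OF _ extends_refl[OF E A(1)]] X[OF S(3) Suc.prems] A(2) ptz0 by metis
  qed (simp add: X0)
  ultimately show ?thesis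
    using that by blast
qed

lemma local_lift_bonding_map:
  assumes "local_lift b F S f L" "F \<subseteq> E"
  shows "local_lift b E S f (\<lambda>z. bonding_map E (L z))"
  unfolding local_lift_def
proof (intro ballI conjI)
  fix z assume z: "z \<in> S"
  show "bonding_map E (L z) \<in> chain_space b E" "endpoint (bonding_map E (L z)) = f z"
    using bonding_map_chain_space[OF local_liftD(1)[OF assms(1) z] assms(2)]
      local_liftD(2)[OF assms(1) z] by auto
  show "eventually (\<lambda>z'. extends E (bonding_map E (L z)) (bonding_map E (L z'))) (at z within S)"
    using local_liftD(3)[OF assms(1) z] by (rule eventually_mono) (rule extends_bonding_map[OF _ assms(2)])
qed

text \<open>The components obtained separately for the various entourages are compatible by uniqueness of
  lifts.\<close>

lemma lift_exists:
  fixes f :: "'z::real_normed_vector \<Rightarrow> 'a::uniform_space"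
  assumes S: "compact S" "convex S" "z0 \<in> S" and f: "continuous_on S f"
    and f0: "f0 \<in> limit_space b" "limit_proj f0 = f z0"
  obtains g where "continuous_map (top_of_set S) (limit_topology b) g" "g z0 = f0"
    "\<And>z. z \<in> S \<Longrightarrow> limit_proj (g z) = f z"
proof -
  have "\<exists>L. local_lift b E S f L \<and> L z0 = f0 E" if E: "entourage E" for E
  proof (rule component_lift_exists[OF S f E])
    show "f0 E \<in> chain_space b E" "endpoint (f0 E) = f z0"
      using limit_space_component[OF f0(1) E] f0(2) by auto
  qed blast
  then obtain L where L: "\<And>E. entourage E \<Longrightarrow> local_lift b E S f (L E)"
    "\<And>E. entourage E \<Longrightarrow> L E z0 = f0 E"
    by metis
  define g where "g z = (\<lambda>E\<in>{E. entourage E}. L E z)" for z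
  have gS: "g z \<in> limit_space b" if z: "z \<in> S" for z
    unfolding limit_space_def
  proof (intro CollectI conjI allI impI)
    show "g z \<in> (\<Pi>\<^sub>E E\<in>{E. entourage E}. chain_space b E)"
      using local_liftD(1)[OF L(1) z] by (auto simp: g_def)
    fix E F :: "('a \<times> 'a) set"
    assume EF: "entourage E \<and> entourage F \<and> F \<subseteq> E"
    have "bonding_map E (L F z) = L E z"
    proof (rule local_lift_unique[OF _ convex_connected[OF S(2)] _ _ S(3) z])
      show "local_lift b E S f (\<lambda>z. bonding_map E (L F z))"
        by (rule local_lift_bonding_map) (use L EF in auto)
      show "bonding_map E (L F z0) = L E z0"
        using L(2) EF f0(1) by (auto simp: limit_space_def)
    qed (use L EF in auto)
    then show "bonding_map E (g z F) = g z E"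
      using EF by (simp add: g_def)
  qed
  show ?thesis
  proof (rule that[of g])
    show "continuous_map (top_of_set S) (limit_topology b) g"
      by (rule local_lift_imp_continuous_map[OF gS f]) (simp_all add: g_def L)
    show "g z0 = f0"
      by (rule limit_space_eqI[OF gS[OF S(3)] f0(1)]) (simp add: g_def L)
    show "limit_proj (g z) = f z" if "z \<in> S" for z
      using local_liftD(2)[OF L(1) that, of UNIV] by (simp add: limit_proj_eq_endpoint g_def)
  qed
qed

section \<open>Triangulating the loops of the inverse limit\<close>

text \<open>Along a sufficiently fine subdivision a lift of a path is obtained by appending the values
  of the path one after the other. Around each parameter \<open>x\<close> this holds for the
  subdivision through \<open>x\<close> itself; compactness of the interval does the rest.\<close>

lemma local_lift_subdivision:
  fixes c :: "real \<Rightarrow> 'a::uniform_space"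
  assumes F: "entourage F" and L: "local_lift b F {0..1} c L" and \<eta>: "0 < \<eta>"
  obtains ts where "ts \<noteq> []" "hd ts = 0" "last ts = 1" "set ts \<subseteq> {0..1}"
    "successively (\<lambda>u v. u \<le> v \<and> v - u < \<eta>) ts"
    "\<And>\<alpha>. L 0 = chain_class F \<alpha> \<Longrightarrow> L 1 = chain_class F (\<alpha> @ map c (tl ts))"
proof -
  define P where "P s t \<longleftrightarrow> (0 \<le> s \<longrightarrow> t \<le> 1 \<longrightarrow> s \<le> t \<longrightarrow>
    (\<exists>ts. ts \<noteq> [] \<and> hd ts = s \<and> last ts = t \<and> set ts \<subseteq> {0..1} \<and>
      successively (\<lambda>u v. u \<le> v \<and> v - u < \<eta>) ts \<and>
      (\<forall>\<alpha>. L s = chain_class F \<alpha> \<longrightarrow> L t = chain_class F (\<alpha> @ map c (tl ts)))))" for s t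
  have "P 0 1"
  proof (rule Bolzano)
    fix r s t assume "P r s" "P s t" "r \<le> s" "s \<le> t"
    show "P r t"
      unfolding P_def
    proof (intro impI)
      assume "0 \<le> r" "t \<le> 1" "r \<le> t"
      then obtain us where us: "us \<noteq> []" "hd us = r" "last us = s" "set us \<subseteq> {0..1}"
        "successively (\<lambda>u v. u \<le> v \<and> v - u < \<eta>) us"
        "\<forall>\<alpha>. L r = chain_class F \<alpha> \<longrightarrow> L s = chain_class F (\<alpha> @ map c (tl us))"
        using \<open>P r s\<close> \<open>r \<le> s\<close> \<open>s \<le> t\<close> unfolding P_def by (smt (verit))
      obtain vs where vs: "vs \<noteq> []" "hd vs = s" "last vs = t" "set vs \<subseteq> {0..1}"
        "successively (\<lambda>u v. u \<le> v \<and> v - u < \<eta>) vs"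
        "\<forall>\<alpha>. L s = chain_class F \<alpha> \<longrightarrow> L t = chain_class F (\<alpha> @ map c (tl vs))"
        using \<open>P s t\<close> \<open>r \<le> s\<close> \<open>s \<le> t\<close> \<open>0 \<le> r\<close> \<open>t \<le> 1\<close> unfolding P_def by (smt (verit))
      let ?ts = "us @ tl vs"
      obtain w where vs': "vs = s # w"
        using vs(1,2) by (cases vs) auto
      have "successively (\<lambda>u v. u \<le> v \<and> v - u < \<eta>) ?ts"
        using us(3,5) vs(5) by (cases w) (auto simp: vs' successively_append_iff)
      moreover have "last ?ts = t"
        using us(1,3) vs(3) by (auto simp: vs')
      moreover have "\<forall>\<alpha>. L r = chain_class F \<alpha> \<longrightarrow> L t = chain_class F (\<alpha> @ map c (tl ?ts))"
        using us(1,6) vs(6) by (auto simp: tl_append2)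
      moreover have "set ?ts \<subseteq> {0..1}"
        using us(4) vs(4) by (auto simp: vs')
      ultimately show "\<exists>ts. ts \<noteq> [] \<and> hd ts = r \<and> last ts = t \<and> set ts \<subseteq> {0..1} \<and>
          successively (\<lambda>u v. u \<le> v \<and> v - u < \<eta>) ts \<and>
          (\<forall>\<alpha>. L r = chain_class F \<alpha> \<longrightarrow> L t = chain_class F (\<alpha> @ map c (tl ts)))"
        using us(1,2) by (intro exI[of _ ?ts]) auto
    qed
  next
    fix x :: real assume x: "0 \<le> x" "x \<le> 1"
    then have x01: "x \<in> {0..1}" by simp
    obtain d where d: "0 < d" "\<And>t. t \<in> {0..1} \<Longrightarrow> t \<noteq> x \<Longrightarrow> dist t x < d \<Longrightarrow> extends F (L x) (L t)"
      using local_liftD(3)[OF L x01] unfolding eventually_at by metis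
    have ext: "extends F (L x) (L t)" if "t \<in> {0..1}" "dist t x < d" for t
      using d(2)[of t] that extends_refl[OF F local_liftD(1)[OF L x01]] by (cases "t = x") auto
    have "P s t" if st: "s \<le> x" "x \<le> t" "t - s < min d \<eta>" for s t
      unfolding P_def
    proof (intro impI exI[of _ "[s, x, t]"] conjI allI)
      assume s: "0 \<le> s" and t: "t \<le> 1"
      show "set [s, x, t] \<subseteq> {0..1}" "successively (\<lambda>u v. u \<le> v \<and> v - u < \<eta>) [s, x, t]"
        using st s t by auto
      fix \<alpha> assume \<alpha>: "L s = chain_class F \<alpha>"
      have "extends F (L s) (L x)" "extends F (L x) (L t)"
        using ext[of s] ext[of t] st s t extends_sym[OF F] by (auto simp: dist_real_def)
      moreover have "endpoint (L x) = c x" "endpoint (L t) = c t"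
        using local_liftD(2)[OF L] st s t by auto
      ultimately have Lx: "L x = chain_class F (\<alpha> @ [c x])"
        using extends_chain_class[of F \<alpha> "L x"] \<alpha> by (metis endpoint_chain_class last_snoc)
      then have "L t = chain_class F ((\<alpha> @ [c x]) @ [c t])"
        using extends_chain_class[of F "\<alpha> @ [c x]" "L t"] \<open>extends F (L x) (L t)\<close> \<open>endpoint (L t) = c t\<close>
        by (metis endpoint_chain_class last_snoc)
      then show "L t = chain_class F (\<alpha> @ map c (tl [s, x, t]))"
        by simp
    qed auto
    then show "\<exists>d>0. \<forall>s t. s \<le> x \<and> x \<le> t \<and> t - s < d \<longrightarrow> P s t"
      using d(1) \<eta> by (intro exI[of _ "min d \<eta>"]) auto
  qed simp
  then show ?thesis
    using that unfolding P_def by auto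
qed

text \<open>When a point \<open>y\<close> is inserted between \<open>x\<close> and \<open>z\<close>, the labels of all three contain \<open>y\<close>, so two
  of them coincide and the reduced word of labels does not change. At the ends of the chain the
  inserted point repeats its neighbour because the endpoints are kept.\<close>

lemma insert_step_foldl_push:
  assumes F: "entourage F" and V: "\<And>x. F `` {x} \<subseteq> V x"
    and order: "\<And>x y z p. p \<in> V x \<Longrightarrow> p \<in> V y \<Longrightarrow> p \<in> V z \<Longrightarrow> collapsible (V x) (V y) (V z)"
    and "insert_step F xs ys" "reduced T"
  shows "foldl push T (map V ys) = foldl push T (map V xs)"
proof -
  obtain us y vs where *: "xs = us @ vs" "ys = us @ y # vs" "chain F xs" "chain F ys"
      "hd xs = hd ys" "last xs = last ys"
    using assms(4) unfolding insert_step_def by blast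
  show ?thesis
  proof (cases us rule: rev_cases)
    case Nil
    then obtain vs' where "vs = y # vs'"
      using * by (cases vs) (auto simp: chain_def)
    then show ?thesis
      using * Nil by simp
  next
    case (snoc us' x)
    show ?thesis
    proof (cases vs)
      case Nil
      then show ?thesis
        using * snoc by simp
    next
      case (Cons z vs')
      have "(y, x) \<in> F" "(y, z) \<in> F"
        using *(2,4) snoc Cons entourage_sym[OF F] by (auto simp: chain_def successively_append_iff)
      then have "(x, y) \<in> F" "(y, y) \<in> F" "(z, y) \<in> F"
        using entourage_sym[OF F] entourage_refl[OF F] by metis+
      then have "y \<in> V x" "y \<in> V y" "y \<in> V z"
        using V by auto
      then have "collapsible (V x) (V y) (V z)"
        by (rule order)
      then show ?thesis
        using foldl_push_collapse[OF assms(5), of "V x" "V y" "V z" "map V us'" "map V vs'"] *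
          snoc Cons by simp
    qed
  qed
qed

lemma chain_homotopic_foldl_push:
  assumes "entourage F" "\<And>x. F `` {x} \<subseteq> V x"
    and "\<And>x y z p. p \<in> V x \<Longrightarrow> p \<in> V y \<Longrightarrow> p \<in> V z \<Longrightarrow> collapsible (V x) (V y) (V z)"
    and "chain_homotopic F xs ys" "reduced T"
  shows "foldl push T (map V xs) = foldl push T (map V ys)"
  using assms(4)
proof (induction rule: chain_homotopic_induct)
  case (step xs ys)
  then show ?case
    by (intro insert_step_foldl_push[symmetric, OF assms(1,2) _ _ assms(5)]) (rule assms(3))
qed simp_all

text \<open>Let \<open>\<alpha>\<close> represent the common class of \<open>g 0\<close> and \<open>g 1\<close>, and let \<open>\<beta>\<close> consist of the values of the
  loop along a fine subdivision. Then \<open>\<alpha>\<close> and \<open>\<alpha> @ \<beta>\<close> are homotopic. Prefixing the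
  inverse of \<open>\<alpha>\<close> cancels \<open>\<alpha>\<close>, so the word of labels of \<open>\<beta>\<close> reduces to a single letter, and
  the loop can be triangulated.\<close>

lemma limit_loop_triangulated:
  fixes b :: "'a::uniform_space"
  assumes dim: "udim_le TYPE('a) 1" and g: "pathin (limit_topology b) g" "g 0 = g 1"
    and E: "entourage E"
  shows "triangulated E (limit_proj \<circ> g) 0 1"
proof -
  let ?c = "limit_proj \<circ> g"
  have g': "continuous_map (top_of_set {0..1}) (limit_topology b) g"
    using g(1) by (simp add: pathin_def)
  obtain G where G: "entourage G" "\<And>x y z. (x, y) \<in> G \<Longrightarrow> (y, z) \<in> G \<Longrightarrow> (x, z) \<in> E"
    by (rule entourage_half[OF E]) blast
  obtain F V where F: "entourage F" and V: "\<And>x. F `` {x} \<subseteq> V x" "\<And>x. V x \<times> V x \<subseteq> G"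
    and order: "\<And>x y z p. p \<in> V x \<Longrightarrow> p \<in> V y \<Longrightarrow> p \<in> V z \<Longrightarrow> collapsible (V x) (V y) (V z)"
    by (rule udim_le_1_labels[OF dim G(1)]) blast
  have VV: "x \<in> V x" for x
    using V(1)[of x] entourage_refl[OF F, of x] by auto
  obtain \<eta> where \<eta>: "0 < \<eta>"
    "\<And>x y. x \<in> {0..1} \<Longrightarrow> y \<in> {0..1} \<Longrightarrow> dist x y < \<eta> \<Longrightarrow> (?c x, ?c y) \<in> F \<inter> E"
    by (rule uniformly_continuous_entourage[OF compact_Icc continuous_on_limit_proj[OF g'] entourage_Int[OF F E]]) blast
  obtain ts where ts: "ts \<noteq> []" "hd ts = 0" "last ts = 1" "set ts \<subseteq> {0..1}"
    "successively (\<lambda>u v. u \<le> v \<and> v - u < \<eta>) ts"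
    "\<And>\<alpha>. g 0 F = chain_class F \<alpha> \<Longrightarrow> g 1 F = chain_class F (\<alpha> @ map ?c (tl ts))"
    by (rule local_lift_subdivision[OF F continuous_map_imp_local_lift[OF F g'] \<eta>(1)]) blast
  have "g 0 \<in> limit_space b"
    using g(1) path_start_in_topspace by fastforce
  from limit_space_component[OF this F] obtain \<alpha> where \<alpha>: "g 0 F = chain_class F \<alpha>" "chain F \<alpha>" "last \<alpha> = ?c 0"
    by (auto simp: chain_space_def)
  then have hom: "chain_homotopic F \<alpha> (\<alpha> @ map ?c (tl ts))"
    using ts(6) g(2) by (simp add: chain_class_eq_iff[symmetric])
  have "\<alpha> \<noteq> []"
    using \<alpha>(2) by (simp add: chain_def)
  let ?v = "V (?c 0)" and ?a = "map V \<alpha>"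
  obtain w where w: "rev ?a = ?v # w"
    using \<open>\<alpha> \<noteq> []\<close> \<alpha>(3) by (cases \<alpha> rule: rev_cases) auto
  \<comment> \<open>The inverse of \<open>\<alpha>\<close> starts at \<open>c 0\<close>, where \<open>\<alpha>\<close> ends.\<close>
  have pal: "foldl push [?v] (rev ?a @ ?a) = [?v]"
    using foldl_push_palindrome[of "[?v]" ?v w] w by (metis list.discI list.sel(1) reduced.simps(4) rev_rev_ident)
  let ?T = "foldl push [?v] (rev ?a)" and ?\<beta> = "map V (map ?c (tl ts))"
  have "reduced ?T"
    by (rule reduced_foldl_push) simp
  have inv: "foldl push ?T ?a = foldl push ?T (map V (\<alpha> @ map ?c (tl ts)))"
    by (rule chain_homotopic_foldl_push[OF F V(1) _ hom \<open>reduced ?T\<close>]) (rule order)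
  have "foldl push [?v] ?\<beta> = foldl push ?T (?a @ ?\<beta>)"
    using pal by simp
  also have "\<dots> = foldl push ?T ?a"
    unfolding inv map_append ..
  also have "\<dots> = [?v]"
    using pal by simp
  finally have "foldl push [?v] ?\<beta> = [?v]" .
  moreover have "map (V \<circ> ?c) ts = ?v # ?\<beta>"
    using ts(1,2) by (cases ts) auto
  ultimately have red: "foldl push [] (map (V \<circ> ?c) ts) = [?v]"
    by simp
  have "triangulated E ?c (hd ts) (last ts)"
  proof (rule triangulated_ear_removal[OF _ _ ts(1) _ red, where adj = "\<lambda>U W. U \<inter> W \<noteq> {}"])
    show "(V \<circ> ?c) x \<inter> (V \<circ> ?c) x \<noteq> {}" for x
      using VV by auto
    show "(?c s, ?c t) \<in> E" if meet: "(V \<circ> ?c) s \<inter> (V \<circ> ?c) t \<noteq> {}" for s t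
    proof -
      obtain p where "p \<in> V (?c s)" "p \<in> V (?c t)"
        using meet by auto
      then have "(?c s, p) \<in> G" "(p, ?c t) \<in> G"
        using V(2) VV by blast+
      then show ?thesis
        by (rule G(2))
    qed
    show "successively (\<lambda>s t. triangulated E ?c s t \<and> (V \<circ> ?c) s \<inter> (V \<circ> ?c) t \<noteq> {}) ts"
    proof (rule successively_mono[OF ts(5)])
      fix u v assume uv: "u \<in> set ts" "v \<in> set ts" "u \<le> v \<and> v - u < \<eta>"
      have u: "0 \<le> u" "v \<le> 1"
        using uv ts(4) by auto
      have "triangulated E ?c u v"
      proof (rule triangulated.small)
        show "(?c x, ?c y) \<in> E" if "x \<in> {u..v}" "y \<in> {u..v}" for x y
          using \<eta>(2)[of x y] that u uv(3) by (auto simp: dist_real_def)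
      qed (use uv in simp)
      moreover have "(?c u, ?c v) \<in> F"
        using \<eta>(2)[of u v] u uv by (auto simp: dist_real_def)
      then have "?c v \<in> V (?c u) \<inter> V (?c v)"
        using V(1) VV by blast
      ultimately show "triangulated E ?c u v \<and> (V \<circ> ?c) u \<inter> (V \<circ> ?c) v \<noteq> {}"
        by auto
    qed
  qed
  then show ?thesis
    using ts(2,3) by simp
qed

section \<open>Null-homotopies and the fundamental group\<close>

lemma continuous_map_reparametrize:
  assumes "continuous_map (top_of_set T) X K" "continuous_on S \<phi>" "\<And>x. x \<in> S \<Longrightarrow> \<phi> x \<in> T"
  shows "continuous_map (top_of_set S) X (\<lambda>x. K (\<phi> x))"
proof -
  have "continuous_map (top_of_set S) (top_of_set T) \<phi>"
    using assms(2,3) by (auto simp: continuous_map_in_subtopology)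
  then show ?thesis
    using continuous_map_compose[OF _ assms(1), of "top_of_set S" \<phi>] by (simp only: comp_def)
qed

lemma limit_loop_null_homotopic_below:
  fixes b :: "'a::uniform_space"
  assumes "udim_le TYPE('a) 1" "pathin (limit_topology b) g" "g 0 = g 1"
  obtains H :: "real \<times> real \<Rightarrow> 'a" where "continuous_on ({0..1} \<times> {0..1}) H"
    "\<And>x. x \<in> {0..1} \<Longrightarrow> H (0, x) = limit_proj (g x)"
    "\<And>x. x \<in> {0..1} \<Longrightarrow> H (1, x) = limit_proj (g 0)"
    "\<And>r. r \<in> {0..1} \<Longrightarrow> H (r, 0) = limit_proj (g 0)"
    "\<And>r. r \<in> {0..1} \<Longrightarrow> H (r, 1) = limit_proj (g 0)"
proof (rule triangulated_imp_null_homotopy[of "limit_proj \<circ> g"])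
  show "continuous_on {0..1} (limit_proj \<circ> g)"
    by (rule continuous_on_limit_proj) (use assms(2) in \<open>simp add: pathin_def\<close>)
  show "triangulated E (limit_proj \<circ> g) 0 1" if "entourage E" for E
    by (rule limit_loop_triangulated[OF assms that])
qed (use assms(3) that in auto)

text \<open>The null-homotopy of the projected loop lifts. By uniqueness of lifts it restricts to \<open>g\<close> on one
  side of the square and to constant maps on the other three.\<close>

lemma limit_loops_null_homotopic:
  fixes b :: "'a::uniform_space"
  assumes "udim_le TYPE('a) 1"
  shows "loops_null_homotopic (limit_topology b)"
  unfolding loops_null_homotopic_def
proof (intro allI impI, elim conjE)
  fix g assume g: "pathin (limit_topology b) g" "g 0 = g 1"
  let ?T = "limit_topology b" and ?I = "{0..1::real}"
  obtain H :: "real \<times> real \<Rightarrow> 'a" where H: "continuous_on (?I \<times> ?I) H"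
    "\<And>x. x \<in> ?I \<Longrightarrow> H (0, x) = limit_proj (g x)"
    "\<And>x. x \<in> ?I \<Longrightarrow> H (1, x) = limit_proj (g 0)"
    "\<And>r. r \<in> ?I \<Longrightarrow> H (r, 0) = limit_proj (g 0)"
    "\<And>r. r \<in> ?I \<Longrightarrow> H (r, 1) = limit_proj (g 0)"
    by (rule limit_loop_null_homotopic_below[OF assms g]) blast
  have g0: "g 0 \<in> limit_space b"
    using path_start_in_topspace[OF g(1)] by simp
  obtain K where K: "continuous_map (top_of_set (?I \<times> ?I)) ?T K" "K (0, 0) = g 0"
    "\<And>z. z \<in> ?I \<times> ?I \<Longrightarrow> limit_proj (K z) = H z"
    by (rule lift_exists[of "?I \<times> ?I" "(0, 0)" H "g 0" b])
      (use H(1,2) g0 in \<open>auto intro!: compact_Times convex_Times\<close>)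
  have side: "K (\<phi> x) = g 0"
    if \<phi>: "continuous_on ?I \<phi>" "\<And>t. t \<in> ?I \<Longrightarrow> \<phi> t \<in> ?I \<times> ?I"
      and "\<And>t. t \<in> ?I \<Longrightarrow> H (\<phi> t) = limit_proj (g 0)" "K (\<phi> 0) = g 0" "x \<in> ?I" for \<phi> x
  proof (rule lift_unique[of ?I b "\<lambda>t. K (\<phi> t)" "\<lambda>_. g 0" 0])
    show "continuous_map (top_of_set ?I) ?T (\<lambda>t. K (\<phi> t))"
      by (rule continuous_map_reparametrize[OF K(1) \<phi>])
  qed (use that g0 K(3) in auto)
  have bottom: "K (0, x) = g x" if "x \<in> ?I" for x
  proof (rule lift_unique[of ?I b "\<lambda>t. K (0, t)" g 0])
    show "continuous_map (top_of_set ?I) ?T (\<lambda>t. K (0, t))"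
      by (rule continuous_map_reparametrize[OF K(1)]) (auto intro!: continuous_intros)
    show "continuous_map (top_of_set ?I) ?T g"
      using g(1) by (simp add: pathin_def)
  qed (use that K(2,3) H(2) in auto)
  have left: "K (r, 0) = g 0" if "r \<in> ?I" for r
    by (rule side[of "\<lambda>r. (r, 0)"]) (use that K(2) H(4) in \<open>auto intro!: continuous_intros\<close>)
  \<comment> \<open>Here it matters that \<open>g\<close> is closed: the lift over this side starts at \<open>g 1\<close>.\<close>
  have right: "K (r, 1) = g 0" if "r \<in> ?I" for r
    by (rule side[of "\<lambda>r. (r, 1)"]) (use that bottom[of 1] g(2) H(5) in \<open>auto intro!: continuous_intros\<close>)
  have top: "K (1, x) = g 0" if "x \<in> ?I" for x
    by (rule side[of "\<lambda>x. (1, x)"]) (use that left[of 1] H(3) in \<open>auto intro!: continuous_intros\<close>)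
  show "homotopic_with (\<lambda>h. h 0 = g 0 \<and> h 1 = g 0) (top_of_set ?I) ?T g (\<lambda>_. g 0)"
  proof (subst homotopic_with, force, intro exI[of _ K] conjI ballI)
    show "continuous_map (prod_topology (top_of_set ?I) (top_of_set ?I)) ?T K"
      using K(1) by (simp add: prod_topology_subtopology_eu)
  qed (use bottom left right top in auto)
qed

lemma is_lift_exists:
  assumes "path c" "c 0 = b"
  obtains g where "is_lift b c g"
proof -
  obtain g where "continuous_map (top_of_set {0..1}) (limit_topology b) g" "g 0 = limit_base b"
      "\<And>t. t \<in> {0..1} \<Longrightarrow> limit_proj (g t) = c t"
    by (rule lift_exists[of "{0..1}" 0 c "limit_base b" b])
      (use assms limit_base_limit_space[of b] in \<open>auto simp: path_def\<close>)
  then show ?thesis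
    using that unfolding is_lift_def pathin_def by blast
qed

lemma is_liftD:
  assumes "is_lift b c g"
  shows "continuous_map (top_of_set {0..1}) (limit_topology b) g" "g 0 = limit_base b"
    "\<And>t. t \<in> {0..1} \<Longrightarrow> limit_proj (g t) = c t"
  using assms unfolding is_lift_def pathin_def by auto

text \<open>Under a homotopy with fixed ends the endpoint of the lift moves in a fibre, along the lift of a
  constant path, and so stays fixed.\<close>

lemma homotopic_paths_lift_endpoints:
  assumes "homotopic_paths UNIV c d" "is_lift b c g" "is_lift b d g'"
  shows "g 1 = g' 1"
proof -
  let ?I = "{0..1::real}"
  note g = is_liftD[OF assms(2)] and g' = is_liftD[OF assms(3)]
  obtain H where "continuous_on (?I \<times> ?I) H" "\<forall>x\<in>?I. H (0, x) = c x" "\<forall>x\<in>?I. H (1, x) = d x"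
      "\<forall>t\<in>?I. pathstart (H \<circ> Pair t) = pathstart c \<and> pathfinish (H \<circ> Pair t) = pathfinish c"
    using assms(1) unfolding homotopic_paths by (elim exE conjE)
  then have H: "continuous_on (?I \<times> ?I) H" "\<And>x. x \<in> ?I \<Longrightarrow> H (0, x) = c x"
      "\<And>x. x \<in> ?I \<Longrightarrow> H (1, x) = d x" "\<And>t. t \<in> ?I \<Longrightarrow> H (t, 0) = c 0" "\<And>t. t \<in> ?I \<Longrightarrow> H (t, 1) = c 1"
    by (simp_all add: pathstart_def pathfinish_def)
  have "c 0 = b"
    using g(2) g(3)[of 0] limit_base_limit_space(2)[of b] by simp
  obtain K where K: "continuous_map (top_of_set (?I \<times> ?I)) (limit_topology b) K" "K (0, 0) = limit_base b"
    "\<And>z. z \<in> ?I \<times> ?I \<Longrightarrow> limit_proj (K z) = H z"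
    by (rule lift_exists[of "?I \<times> ?I" "(0, 0)" H "limit_base b" b])
      (use H(1,2) limit_base_limit_space[of b] \<open>c 0 = b\<close> in \<open>auto intro!: compact_Times convex_Times\<close>)
  have side: "K (\<phi> x) = f x"
    if \<phi>: "continuous_on ?I \<phi>" "\<And>t. t \<in> ?I \<Longrightarrow> \<phi> t \<in> ?I \<times> ?I"
      and "continuous_map (top_of_set ?I) (limit_topology b) f"
      and "\<And>t. t \<in> ?I \<Longrightarrow> H (\<phi> t) = limit_proj (f t)" "K (\<phi> 0) = f 0" "x \<in> ?I" for \<phi> f x
  proof (rule lift_unique[of ?I b "\<lambda>t. K (\<phi> t)" f 0])
    show "continuous_map (top_of_set ?I) (limit_topology b) (\<lambda>t. K (\<phi> t))"
      by (rule continuous_map_reparametrize[OF K(1) \<phi>])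
  qed (use that K(3) in auto)
  have K0: "K (0, x) = g x" if "x \<in> ?I" for x
    by (rule side[of "\<lambda>x. (0, x)"]) (use that g K(2) H(2) in \<open>auto intro!: continuous_intros\<close>)
  have Kl: "K (t, 0) = limit_base b" if "t \<in> ?I" for t
    by (rule side[of "\<lambda>t. (t, 0)" "\<lambda>_. limit_base b"])
      (use that K(2) H(4) \<open>c 0 = b\<close> limit_base_limit_space[of b] in \<open>auto intro!: continuous_intros\<close>)
  have K1: "K (1, x) = g' x" if "x \<in> ?I" for x
    by (rule side[of "\<lambda>x. (1, x)"]) (use that g' Kl[of 1] H(3) in \<open>auto intro!: continuous_intros\<close>)
  have g1: "g 1 \<in> limit_space b"
    using g(1) by (auto simp: continuous_map_def)
  have "K (1, 1) = g 1"
    by (rule side[of "\<lambda>t. (t, 1)" "\<lambda>_. g 1"])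
      (use g1 K0[of 1] g(3)[of 1] H(5) in \<open>auto intro!: continuous_intros\<close>)
  then show ?thesis
    using K1[of 1] by simp
qed

lemma pi1_to_delta1_eq:
  assumes "path c" "is_lift b c g"
  shows "pi1_to_delta1 b (Collect (homotopic_paths UNIV c)) = g 1"
  unfolding pi1_to_delta1_def
proof (rule the_equality)
  show "\<exists>d\<in>Collect (homotopic_paths UNIV c). \<exists>h. is_lift b d h \<and> h 1 = g 1"
    using assms by (intro bexI[of _ c]) auto
  show "z = g 1" if "\<exists>d\<in>Collect (homotopic_paths UNIV c). \<exists>h. is_lift b d h \<and> h 1 = z" for z
    using that homotopic_paths_lift_endpoints[OF _ assms(2)] by auto
qed

text \<open>The loop runs along the side \<open>{0} \<times> [0, 1]\<close> of the square. Its halves are joined within the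
  convex square by the segments from the midpoint of that side to a point \<open>(\<psi>1 t, \<psi>2 t)\<close> that
  travels around the other three sides, on which \<open>H\<close> is constant.\<close>

lemma null_homotopic_loop_imp_homotopic_halves:
  fixes H :: "real \<times> real \<Rightarrow> 'a::topological_space"
  assumes H: "continuous_on ({0..1} \<times> {0..1}) H"
    and sides: "\<And>x. x \<in> {0..1} \<Longrightarrow> H (1, x) = p" "\<And>r. r \<in> {0..1} \<Longrightarrow> H (r, 0) = p"
      "\<And>r. r \<in> {0..1} \<Longrightarrow> H (r, 1) = p"
    and c: "\<And>x. x \<in> {0..1} \<Longrightarrow> H (0, x / 2) = c x"
    and d: "\<And>x. x \<in> {0..1} \<Longrightarrow> H (0, 1 - x / 2) = d x"
  shows "homotopic_paths UNIV c d"
proof -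
  define \<psi>1 :: "real \<Rightarrow> real" where "\<psi>1 t = min 1 (min (3 * t) (3 - 3 * t))" for t
  define \<psi>2 :: "real \<Rightarrow> real" where "\<psi>2 t = max 0 (min 1 (3 * t - 1))" for t
  define \<phi> where "\<phi> = (\<lambda>(t, x). ((1 - x) * \<psi>1 t, (1 - x) * \<psi>2 t + x * (1 / 2)))"
  have \<psi>: "\<psi>1 t \<in> {0..1}" "\<psi>2 t \<in> {0..1}" if "t \<in> {0..1}" for t
    using that by (auto simp: \<psi>1_def \<psi>2_def)
  have \<phi>: "\<phi> z \<in> {0..1} \<times> {0..1}" if "z \<in> {0..1} \<times> {0..1}" for z
  proof (cases z)
    case (Pair t x)
    then have x: "0 \<le> x" "x \<le> 1" and t: "t \<in> {0..1}"
      using that by auto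
    have "(1 - x) * \<psi>2 t + x * (1 / 2) \<le> 1"
      using \<psi>(2)[OF t] x by (intro convex_bound_le) auto
    then show ?thesis
      using \<psi>[OF t] x Pair by (auto simp: \<phi>_def intro!: mult_le_one)
  qed
  have cont: "continuous_on ({0..1} \<times> {0..1}) (\<lambda>z. H (\<phi> z))"
  proof (rule continuous_on_compose2[OF H])
    show "continuous_on ({0..1} \<times> {0..1}) \<phi>"
      unfolding \<phi>_def \<psi>1_def \<psi>2_def split_beta' by (intro continuous_intros)
    show "\<phi> ` ({0..1} \<times> {0..1}) \<subseteq> {0..1} \<times> {0..1}"
      using \<phi> by blast
  qed
  have start: "H (\<phi> (t, 0)) = p" if t: "t \<in> {0..1}" for t
  proof -
    have "\<psi>2 t = 0 \<or> \<psi>1 t = 1 \<or> \<psi>2 t = 1"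
      by (auto simp: \<psi>1_def \<psi>2_def)
    then show ?thesis
      using \<psi>[OF t] sides by (auto simp: \<phi>_def)
  qed
  have "c 0 = p" "c 1 = H (0, 1 / 2)"
    using c[of 0] c[of 1] sides by auto
  moreover have "H (\<phi> (0, x)) = c x" if "x \<in> {0..1}" for x
    using c[OF that] by (simp add: \<phi>_def \<psi>1_def \<psi>2_def)
  moreover have "H (\<phi> (1, x)) = d x" if "x \<in> {0..1}" for x
    using d[OF that] by (simp add: \<phi>_def \<psi>1_def \<psi>2_def field_simps)
  moreover have "H (\<phi> (t, 1)) = H (0, 1 / 2)" for t
    by (simp add: \<phi>_def)
  ultimately show ?thesis
    unfolding homotopic_paths using cont start
    by (intro exI[of _ "\<lambda>z. H (\<phi> z)"]) (auto simp: pathstart_def pathfinish_def)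
qed

text \<open>Lifts with the same endpoint combine to a loop over \<open>c\<close> followed by the inverse of \<open>d\<close>, and
  the projection of this loop is null-homotopic.\<close>

lemma equal_lift_endpoints_imp_homotopic:
  fixes b :: "'a::uniform_space"
  assumes dim: "udim_le TYPE('a) 1"
    and c: "path c" "c 0 = b" "is_lift b c g" and d: "path d" "d 0 = b" "is_lift b d h"
    and eq: "g 1 = h 1"
  shows "homotopic_paths UNIV c d"
proof -
  let ?I = "{0..1::real}"
  note g = is_liftD[OF c(3)] and h = is_liftD[OF d(3)]
  let ?e = "c +++ reversepath d"
  have "c 1 = d 1"
    using g(3)[of 1] h(3)[of 1] eq by simp
  then have "path ?e"
    using c(1) d(1) by (simp add: pathfinish_def pathstart_def reversepath_def)
      (simp add: pathfinish_def pathstart_def flip: reversepath_def)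
  have e0: "?e 0 = b" and e1: "?e 1 = b"
    using c(2) d(2) by (auto simp: joinpaths_def reversepath_def)
  have ec: "?e (x / 2) = c x" if "x \<in> ?I" for x
    using that by (simp add: joinpaths_def)
  have ed: "?e (1 - x / 2) = d x" if "x \<in> ?I" for x
    using that \<open>c 1 = d 1\<close> by (auto simp: joinpaths_def reversepath_def)
  obtain G where "is_lift b ?e G"
    by (rule is_lift_exists[OF \<open>path ?e\<close> e0])
  note G = is_liftD[OF this]
  have "G (x / 2) = g x" if "x \<in> ?I" for x
  proof (rule lift_unique[of ?I b "\<lambda>x. G (x / 2)" g 0])
    show "continuous_map (top_of_set ?I) (limit_topology b) (\<lambda>x. G (x / 2))"
      by (rule continuous_map_reparametrize[OF G(1)]) (auto intro!: continuous_intros)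
  qed (use that g G ec in auto)
  from this[of 1] have G12: "G (1 / 2) = h 1"
    using eq by simp
  have "G (1 - x / 2) = h x" if "x \<in> ?I" for x
  proof (rule lift_unique[of ?I b "\<lambda>x. G (1 - x / 2)" h 1])
    show "continuous_map (top_of_set ?I) (limit_topology b) (\<lambda>x. G (1 - x / 2))"
      by (rule continuous_map_reparametrize[OF G(1)]) (auto intro!: continuous_intros)
  qed (use that h G ed G12 in auto)
  from this[of 0] have "G 0 = G 1"
    using h(2) G(2) by simp
  obtain H :: "real \<times> real \<Rightarrow> 'a" where H: "continuous_on (?I \<times> ?I) H"
    "\<And>x. x \<in> ?I \<Longrightarrow> H (0, x) = limit_proj (G x)"
    "\<And>x. x \<in> ?I \<Longrightarrow> H (1, x) = limit_proj (G 0)"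
    "\<And>r. r \<in> ?I \<Longrightarrow> H (r, 0) = limit_proj (G 0)"
    "\<And>r. r \<in> ?I \<Longrightarrow> H (r, 1) = limit_proj (G 0)"
    by (rule limit_loop_null_homotopic_below[OF dim _ \<open>G 0 = G 1\<close>])
      (use G(1) in \<open>auto simp: pathin_def\<close>)
  show ?thesis
  proof (rule null_homotopic_loop_imp_homotopic_halves[OF H(1,3,4,5)])
    show "H (0, x / 2) = c x" if "x \<in> ?I" for x
      using that H(2)[of "x / 2"] G(3)[of "x / 2"] ec[OF that] by auto
    show "H (0, 1 - x / 2) = d x" if "x \<in> ?I" for x
      using that H(2)[of "1 - x / 2"] G(3)[of "1 - x / 2"] ed[OF that] by auto
  qed
qed

theorem theorem90:
  fixes b :: "'a::uniform_space"
  assumes "coverable b"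
    and "udim_le TYPE('a) 1 \<or> (compact (UNIV :: 'a set) \<and> covering_dim_le TYPE('a) 1)"
  shows "loops_null_homotopic (limit_topology b) \<and>
    (path_connected (UNIV :: 'a set) \<longrightarrow>
       inj_on (pi1_to_delta1 b) (fundamental_group_carrier b))"
proof (intro conjI impI)
  have dim: "udim_le TYPE('a) 1"
    using assms(2) compact_covering_dim_imp_udim by blast
  then show "loops_null_homotopic (limit_topology b)"
    by (rule limit_loops_null_homotopic)
  show "inj_on (pi1_to_delta1 b) (fundamental_group_carrier b)"
  proof (rule inj_onI)
    fix C D
    assume "C \<in> fundamental_group_carrier b" "D \<in> fundamental_group_carrier b"
    then obtain c d where c: "C = Collect (homotopic_paths UNIV c)" "path c" "c 0 = b"
      and d: "D = Collect (homotopic_paths UNIV d)" "path d" "d 0 = b"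
      by (auto simp: fundamental_group_carrier_def pathstart_def)
    obtain g where g: "is_lift b c g"
      by (rule is_lift_exists[OF c(2,3)])
    obtain h where h: "is_lift b d h"
      by (rule is_lift_exists[OF d(2,3)])
    assume "pi1_to_delta1 b C = pi1_to_delta1 b D"
    then have "g 1 = h 1"
      using pi1_to_delta1_eq[OF c(2) g] pi1_to_delta1_eq[OF d(2) h] c(1) d(1) by simp
    then have "homotopic_paths UNIV c d"
      by (rule equal_lift_endpoints_imp_homotopic[OF dim c(2,3) g d(2,3) h])
    then show "C = D"
      unfolding c(1) d(1) by (auto intro: homotopic_paths_trans homotopic_paths_sym)
  qed
qed

end
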